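(* Let $(X_\infty,f_\infty)$ and $(Y_\infty,g_\infty)$ be topological NDS with fine-scale IMS $\mu_\infty$ and $\nu_\infty$, respectively, and consider the direct product system $(X_\infty\times Y_\infty,f_\infty\times g_\infty)$ (spaces $X_n\times Y_n$, maps $f_n\times g_n$, metrics $d_n^\times((x_1,y_1),(x_2,y_2))=\max\{d_n^X(x_1,x_2),d_n^Y(y_1,y_2)\}$) with the IMS $\mu_\infty\times\nu_\infty=(\mu_n\times\nu_n)_{n\ge0}$. Then, under each of the following three conditions, the equality $$h(f_\infty\times g_\infty,\mu_\infty\times\nu_\infty)=h(f_\infty,\mu_\infty)+h(g_\infty,\nu_\infty)$$ holds: (a) $h(g_\infty,\nu_\infty)=0$. In this case, $h(f_\infty\times g_\infty,\mu_\infty\times\nu_\infty)=h(f_\infty,\mu_\infty)$. (b) One of the systems is autonomous, say $(Y_n,g_n,\nu_n)\equiv(Y,g,\nu)$ for all $n$. In this case, $h(f_\infty\times g_\infty,\mu_\infty\times\nu_\infty)=h(f_\infty,\mu_\infty)+h_\nu(g)$, where $h_\nu(g)$ is the Kolmogorov–Sinai entropy of $g$ with respect to $\nu$. (c) $(X_\infty,f_\infty)=(Y_\infty,g_\infty)$ and $\mu_\infty=\nu_\infty$. In this case, $h(f_\infty\times f_\infty,\mu_\infty\times\mu_\infty)=2h(f_\infty,\mu_\infty)$.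
   Context: A topological nonautonomous dynamical system (topological NDS) $(X_\infty,f_\infty)$ consists of a sequence $X_\infty=(X_n)_{n\ge0}$ of nonempty compact metric spaces $(X_n,d_n)$ and an equicontinuous sequence $f_\infty=(f_n)_{n\ge0}$ of maps $f_n:X_n\to X_{n+1}$, i.e. for every $\varepsilon>0$ there is $\delta>0$ such that for all $n\ge0$ and $x,y\in X_n$, $d_n(x,y)<\delta$ implies $d_{n+1}(f_n(x),f_n(y))<\varepsilon$. Put $f_k^n:=f_{k+n-1}\circ\cdots\circ f_k$ for $n\ge1$, $f_k^0:=\mathrm{id}_{X_k}$, $f_k^{-n}:=(f_k^n)^{-1}$ (applied to sets only). An invariant measure sequence (IMS) is a sequence $\mu_\infty=(\mu_n)_{n\ge0}$ of Borel probability measures $\mu_n$ on $X_n$ with $f_n\mu_n=\mu_{n+1}$ (push-forward) for all $n$. $\mathcal{E}_{\mathrm M}(\mu_\infty)$ is the family of admissible sequences: a sequence $\mathcal{P}_\infty=(\mathcal{P}_n)_{n\ge0}$ of finite Borel partitions $\mathcal{P}_n=\{P_{n,1},\dots,P_{n,k_n}\}$ of $X_n$ is in $\mathcal{E}_{\mathrm M}(\mu_\infty)$ iff $(k_n)$ is bounded and for each $\varepsilon>0$ there are $\delta>0$ and compact (possibly empty) sets $K_{n,i}\subset P_{n,i}$ such that for all $n\ge0$: (a) $\mu_n(P_{n,i}\setminus K_{n,i})\le\varepsilon$ for $i=1,\dots,k_n$; (b) for $1\le i<j\le k_n$, $d_n(x,y)\ge\delta$ for all $x\in K_{n,i}$,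 $y\in K_{n,j}$. $h(f_\infty,\mu_\infty;\mathcal{P}_\infty):=\limsup_{n\to\infty}\frac1nH_{\mu_0}\big(\bigvee_{i=0}^{n-1}f_0^{-i}\mathcal{P}_i\big)$ with $H_\mu(\mathcal{P})=-\sum_{P\in\mathcal{P}}\mu(P)\log\mu(P)$, and the metric entropy is $h(f_\infty,\mu_\infty):=\sup_{\mathcal{P}_\infty\in\mathcal{E}_{\mathrm M}(\mu_\infty)}h(f_\infty,\mu_\infty;\mathcal{P}_\infty)\in[0,\infty]$. $\operatorname{diam}\mathcal{P}_\infty:=\sup_{n\ge0}\sup_{P\in\mathcal{P}_n}\operatorname{diam}P$. An IMS $\mu_\infty$ is a fine-scale IMS if there is a sequence $(\mathcal{P}^k_\infty)_{k\ge0}$ in $\mathcal{E}_{\mathrm M}(\mu_\infty)$ with $\operatorname{diam}\mathcal{P}^k_\infty\to0$ as $k\to\infty$. *)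

theory Defs
  imports "HOL-Probability.Probability"
begin

section \<open>Compact metric spaces, product metric, Borel sets\<close>

text \<open>
  A sequence of metric spaces is a function \<open>X :: nat \<Rightarrow> 'a metric\<close>. The spaces \<open>mspace (X n)\<close> may
  differ arbitrarily as subsets of the type \<open>'a\<close>, and each carries its own metric.
\<close>

lemma Metric_space_max:
  "Metric_space (mspace m1 \<times> mspace m2)
     (\<lambda>p q. max (mdist m1 (fst p) (fst q)) (mdist m2 (snd p) (snd q)))"
proof (unfold_locales, goal_cases)
  case (1 x y)
  then show ?case by (simp add: le_max_iff_disj)
next
  case (2 x y)
  then show ?case by (simp add: mdist_commute)
next
  case (3 x y)
  have nn: "0 \<le> mdist m1 (fst x) (fst y)" "0 \<le> mdist m2 (snd x) (snd y)" by auto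
  have "max (mdist m1 (fst x) (fst y)) (mdist m2 (snd x) (snd y)) = 0 \<longleftrightarrow>
      mdist m1 (fst x) (fst y) = 0 \<and> mdist m2 (snd x) (snd y) = 0"
    using nn by linarith
  then show ?case using 3 by (simp add: mem_Times_iff prod_eq_iff)
next
  case (4 x y z)
  then have "mdist m1 (fst x) (fst z) \<le> mdist m1 (fst x) (fst y) + mdist m1 (fst y) (fst z)"
    "mdist m2 (snd x) (snd z) \<le> mdist m2 (snd x) (snd y) + mdist m2 (snd y) (snd z)"
    by (auto intro!: mdist_triangle)
  then show ?case by linarith
qed

text \<open>The library's \<^const>\<open>prod_metric\<close> is the Euclidean one, hence the following.\<close>

definition max_metric :: "'a metric \<Rightarrow> 'b metric \<Rightarrow> ('a \<times> 'b) metric" where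
  "max_metric m1 m2 = metric (mspace m1 \<times> mspace m2,
     \<lambda>p q. max (mdist m1 (fst p) (fst q)) (mdist m2 (snd p) (snd q)))"

lemma mspace_max_metric [simp]: "mspace (max_metric m1 m2) = mspace m1 \<times> mspace m2"
  using Metric_space.mspace_metric[OF Metric_space_max] by (simp add: max_metric_def)

lemma mdist_max_metric [simp]:
  "mdist (max_metric m1 m2) p q = max (mdist m1 (fst p) (fst q)) (mdist m2 (snd p) (snd q))"
  by (simp add: max_metric_def Metric_space.mdist_metric[OF Metric_space_max])

definition mborel :: "'a metric \<Rightarrow> 'a measure" where
  "mborel m = sigma (mspace m) {U. openin (mtopology_of m) U}"

section \<open>Topological nonautonomous dynamical systems\<close>

definition topological_nds :: "(nat \<Rightarrow> 'a metric) \<Rightarrow> (nat \<Rightarrow> 'a \<Rightarrow> 'a) \<Rightarrow> bool" where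
  "topological_nds X f \<longleftrightarrow>
     (\<forall>n. mspace (X n) \<noteq> {} \<and> compact_space (mtopology_of (X n))) \<and>
     (\<forall>n. f n \<in> mspace (X n) \<rightarrow> mspace (X (Suc n))) \<and>
     (\<forall>\<epsilon>>0. \<exists>\<delta>>0. \<forall>n. \<forall>x\<in>mspace (X n). \<forall>y\<in>mspace (X n).
        mdist (X n) x y < \<delta> \<longrightarrow> mdist (X (Suc n)) (f n x) (f n y) < \<epsilon>)"

text \<open>\<open>nds_iter f k n\<close> is $f_k^n = f_{k+n-1} \circ \cdots \circ f_k$.\<close>

primrec nds_iter :: "(nat \<Rightarrow> 'a \<Rightarrow> 'a) \<Rightarrow> nat \<Rightarrow> nat \<Rightarrow> 'a \<Rightarrow> 'a" where
  "nds_iter f k 0 = id"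
| "nds_iter f k (Suc n) = f (k + n) \<circ> nds_iter f k n"

definition ims :: "(nat \<Rightarrow> 'a metric) \<Rightarrow> (nat \<Rightarrow> 'a \<Rightarrow> 'a) \<Rightarrow> (nat \<Rightarrow> 'a measure) \<Rightarrow> bool" where
  "ims X f \<mu> \<longleftrightarrow>
     (\<forall>n. prob_space (\<mu> n) \<and> space (\<mu> n) = mspace (X n) \<and> sets (\<mu> n) = sets (mborel (X n))) \<and>
     (\<forall>n. distr (\<mu> n) (\<mu> (Suc n)) (f n) = \<mu> (Suc n))"

section \<open>Partitions and metric entropy\<close>

definition borel_partition :: "'a metric \<Rightarrow> 'a set set \<Rightarrow> bool" where
  "borel_partition m P \<longleftrightarrow> finite P \<and> partition_on (mspace m) P \<and> P \<subseteq> sets (mborel m)"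

text \<open>
  The cells of a partition are not enumerated: the compact subset assigned to the cell
  \<open>A \<in> P n\<close> is \<open>K n A\<close>.
\<close>

definition admissible ::
    "(nat \<Rightarrow> 'a metric) \<Rightarrow> (nat \<Rightarrow> 'a measure) \<Rightarrow> (nat \<Rightarrow> 'a set set) set" where
  "admissible X \<mu> = {P.
     (\<forall>n. borel_partition (X n) (P n)) \<and>
     (\<exists>k. \<forall>n. card (P n) \<le> k) \<and>
     (\<forall>\<epsilon>>0. \<exists>\<delta>>0. \<exists>K.
        (\<forall>n. \<forall>A\<in>P n. compactin (mtopology_of (X n)) (K n A) \<and> K n A \<subseteq> A \<and>
           measure (\<mu> n) (A - K n A) \<le> \<epsilon>) \<and>
        (\<forall>n. \<forall>A\<in>P n. \<forall>B\<in>P n. A \<noteq> B \<longrightarrow>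
           (\<forall>x\<in>K n A. \<forall>y\<in>K n B. mdist (X n) x y \<ge> \<delta>)))}"

definition partition_entropy :: "'a measure \<Rightarrow> 'a set set \<Rightarrow> real" where
  "partition_entropy M P = - (\<Sum>A\<in>P. measure M A * ln (measure M A))"

definition pullback_partition :: "'a set \<Rightarrow> ('a \<Rightarrow> 'b) \<Rightarrow> 'b set set \<Rightarrow> 'a set set" where
  "pullback_partition S T P = (\<lambda>A. T -` A \<inter> S) ` P - {{}}"

definition nds_entropy_partition ::
    "(nat \<Rightarrow> 'a metric) \<Rightarrow> (nat \<Rightarrow> 'a \<Rightarrow> 'a) \<Rightarrow> (nat \<Rightarrow> 'a measure) \<Rightarrow> (nat \<Rightarrow> 'a set set) \<Rightarrow> ereal"
  where
  "nds_entropy_partition X f \<mu> P = limsup (\<lambda>n. ereal (1 / real n * partition_entropy (\<mu> 0)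
     (common_refinement ((\<lambda>i. pullback_partition (mspace (X 0)) (nds_iter f 0 i) (P i)) ` {..<n}))))"

definition nds_entropy ::
    "(nat \<Rightarrow> 'a metric) \<Rightarrow> (nat \<Rightarrow> 'a \<Rightarrow> 'a) \<Rightarrow> (nat \<Rightarrow> 'a measure) \<Rightarrow> ereal" where
  "nds_entropy X f \<mu> = (SUP P\<in>admissible X \<mu>. nds_entropy_partition X f \<mu> P)"

definition seq_diam :: "(nat \<Rightarrow> 'a metric) \<Rightarrow> (nat \<Rightarrow> 'a set set) \<Rightarrow> ennreal" where
  "seq_diam X P = (SUP n. SUP A\<in>P n. SUP x\<in>A. SUP y\<in>A. ennreal (mdist (X n) x y))"

definition fine_scale_ims ::
    "(nat \<Rightarrow> 'a metric) \<Rightarrow> (nat \<Rightarrow> 'a \<Rightarrow> 'a) \<Rightarrow> (nat \<Rightarrow> 'a measure) \<Rightarrow> bool" where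
  "fine_scale_ims X f \<mu> \<longleftrightarrow> ims X f \<mu> \<and>
     (\<exists>P :: nat \<Rightarrow> nat \<Rightarrow> 'a set set. (\<forall>k. P k \<in> admissible X \<mu>) \<and>
        (\<lambda>k. seq_diam X (P k)) \<longlonglongrightarrow> 0)"

section \<open>Autonomous systems and Kolmogorov--Sinai entropy\<close>

text \<open>Maps matter on the space only, so they are compared there.\<close>

definition autonomous ::
    "(nat \<Rightarrow> 'a metric) \<Rightarrow> (nat \<Rightarrow> 'a \<Rightarrow> 'a) \<Rightarrow> (nat \<Rightarrow> 'a measure) \<Rightarrow>
     'a metric \<Rightarrow> ('a \<Rightarrow> 'a) \<Rightarrow> 'a measure \<Rightarrow> bool" where
  "autonomous X f \<mu> m T M \<longleftrightarrow>
     (\<forall>n. X n = m \<and> (\<forall>x\<in>mspace m. f n x = T x) \<and> \<mu> n = M)"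

text \<open>
  For a measure-preserving \<open>T\<close> on a probability space \<open>M\<close> the limit exists by subadditivity;
  the supremum is over all finite measurable partitions.
\<close>

definition ks_entropy :: "'a measure \<Rightarrow> ('a \<Rightarrow> 'a) \<Rightarrow> ereal" where
  "ks_entropy M T = (SUP Q\<in>{Q. finite Q \<and> partition_on (space M) Q \<and> Q \<subseteq> sets M}.
     lim (\<lambda>n. ereal (1 / real n * partition_entropy M
       (common_refinement ((\<lambda>i. pullback_partition (space M) (T ^^ i) Q) ` {..<n})))))"

section \<open>Direct products\<close>

definition prod_spaces :: "(nat \<Rightarrow> 'a metric) \<Rightarrow> (nat \<Rightarrow> 'b metric) \<Rightarrow> nat \<Rightarrow> ('a \<times> 'b) metric" where
  "prod_spaces X Y n = max_metric (X n) (Y n)"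

definition prod_maps ::
    "(nat \<Rightarrow> 'a \<Rightarrow> 'a) \<Rightarrow> (nat \<Rightarrow> 'b \<Rightarrow> 'b) \<Rightarrow> nat \<Rightarrow> 'a \<times> 'b \<Rightarrow> 'a \<times> 'b" where
  "prod_maps f g n = map_prod (f n) (g n)"

text \<open>
  On compact (hence second countable) spaces, the product sigma-algebra of \<^term>\<open>M \<Otimes>\<^sub>M N\<close>
  is the Borel sigma-algebra of the product space.
\<close>

definition prod_measures ::
    "(nat \<Rightarrow> 'a measure) \<Rightarrow> (nat \<Rightarrow> 'b measure) \<Rightarrow> nat \<Rightarrow> ('a \<times> 'b) measure" where
  "prod_measures \<mu> \<nu> n = \<mu> n \<Otimes>\<^sub>M \<nu> n"

end

theory Submission
  imports Defs
begin

text \<open>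
  If the cells of \<open>P\<^sub>n\<close> are finer than the separation of the compact cores of an admissible
  \<open>Q\<^sub>n\<close>, then off a set of small measure the \<open>Q\<^sub>n\<close>-cell of a point is a function of its
  \<open>P\<^sub>n\<close>-cell. Hence fine-scale sequences compute the entropy up to an arbitrarily small error,
  and on a product system it suffices to consider products of fine sequences, whose entropies at
  each time are additive. Subadditivity of the limsup yields the upper bound; the converse needs the limsup
  to be additive, which holds trivially when one entropy vanishes or both factors agree, and by
  Fekete's lemma for constant partition sequences of an autonomous system. By regularity of Borel
  measures all such constant sequences are admissible, and they exhaust the entropy.
\<close>

section \<open>Entropy of finite-valued functions\<close>

text \<open>Partitions are traded for finite-valued functions: joining becomes pairing or listing of
  values and pulling back becomes composition, so the chain rule and data processing for simple
  functions apply directly. The comparison with a fine sequence is made at one time and then summed.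
  The function that repairs the wrong guesses at time \<open>i\<close> has entropy at most
  \<open>e\<close> for every \<open>i\<close>, because the number of cells is bounded and a single
  \<delta> separates the cores at all times. Adding \<open>n\<close> such errors and dividing by
  \<open>n\<close> leaves \<open>e\<close>. The obstacle on the product is that the cells of an
  admissible sequence need not be rectangles. Its cores are nevertheless separated in the max
  metric, and rectangles with both sides finer than that separation are fine enough for the
  comparison. In an autonomous system the metric never changes, so one member of a fine sequence,
  repeated at all times, is again fine. This is why constant sequences exhaust the entropy
  there.\<close>

definition fun_entropy :: "'a measure \<Rightarrow> ('a \<Rightarrow> 'b) \<Rightarrow> real" where
  "fun_entropy M p = - (\<Sum>c\<in>p ` space M. measure M (p -` {c} \<inter> space M) * ln (measure M (p -` {c} \<inter> space M)))"

context prob_space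
begin

text \<open>Base \<open>exp 1\<close> turns the \<open>log\<close> of the library's information
  theory into the \<open>ln\<close> of \<open>partition_entropy\<close>.\<close>

lemma information_space_exp: "information_space M (exp 1)"
  by unfold_locales simp

lemma fun_entropy_eq_entropy:
  assumes "simple_function M p"
  shows "fun_entropy M p = entropy (exp 1) (count_space (p ` space M)) p"
  using information_space.entropy_simple_distributed
      [OF information_space_exp simple_distributedI[OF assms measure_nonneg refl]]
  by (simp add: fun_entropy_def log_def)

lemma fun_entropy_nonneg: "0 \<le> fun_entropy M p"
  unfolding fun_entropy_def sum_negf[symmetric]
proof (rule sum_nonneg)
  fix c
  have "x * ln x \<le> 0" if "0 \<le> x" "x \<le> 1" for x :: real
    using that by (cases "x = 0") (auto simp: mult_nonneg_nonpos)
  then show "0 \<le> - (prob (p -` {c} \<inter> space M) * ln (prob (p -` {c} \<inter> space M)))"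
    by simp
qed

text \<open>Chain rule, then conditioning on \<open>p\<close> does not increase the entropy of
  \<open>q\<close>.\<close>

lemma fun_entropy_Pair_le:
  assumes "simple_function M p" "simple_function M q"
  shows "fun_entropy M (\<lambda>x. (p x, q x)) \<le> fun_entropy M p + fun_entropy M q"
proof -
  interpret information_space M "exp 1" by (rule information_space_exp)
  show ?thesis
    using entropy_chain_rule[OF assms] conditional_entropy_less_eq_entropy[OF assms(2,1)]
    by (simp add: fun_entropy_eq_entropy assms simple_function_Pair)
qed

lemma fun_entropy_cong:
  assumes "\<And>x. x \<in> space M \<Longrightarrow> p x = q x"
  shows "fun_entropy M p = fun_entropy M q"
proof -
  have "p ` space M = q ` space M" "\<And>c. p -` {c} \<inter> space M = q -` {c} \<inter> space M"
    using assms by (auto intro: image_cong)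
  then show ?thesis by (simp add: fun_entropy_def)
qed

text \<open>On the space \<open>p\<close> factors through \<open>q\<close>, so this is the data
  processing inequality.\<close>

lemma fun_entropy_mono:
  assumes q: "simple_function M q"
    and pq: "\<And>x y. x \<in> space M \<Longrightarrow> y \<in> space M \<Longrightarrow> q x = q y \<Longrightarrow> p x = p y"
  shows "fun_entropy M p \<le> fun_entropy M q"
proof -
  interpret information_space M "exp 1" by (rule information_space_exp)
  \<comment> \<open>The factor map: \<open>p\<close> evaluated at some point where \<open>q\<close>
    takes the value \<open>c\<close>. By \<open>pq\<close> the choice of the point is
    immaterial.\<close>
  define h where "h c = p (SOME x. x \<in> space M \<and> q x = c)" for c
  have h: "p x = (h \<circ> q) x" if "x \<in> space M" for x
  proof -
    have "(SOME y. y \<in> space M \<and> q y = q x) \<in> space M \<and> q (SOME y. y \<in> space M \<and> q y = q x) = q x"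
      by (rule someI[of _ x]) (use that in auto)
    then have "p (SOME y. y \<in> space M \<and> q y = q x) = p x" using that by (intro pq) auto
    then show ?thesis by (simp add: h_def)
  qed
  have "fun_entropy M p = fun_entropy M (h \<circ> q)" by (rule fun_entropy_cong) (rule h)
  also have "\<dots> \<le> fun_entropy M q"
    using entropy_data_processing[OF q, of h]
    by (simp add: fun_entropy_eq_entropy q simple_function_compose)
  finally show ?thesis .
qed

text \<open>Entropy sees only the level sets. This form allows the two functions to have values of
  different types.\<close>

lemma fun_entropy_cong_kernel:
  assumes "simple_function M p" "simple_function M q"
    and "\<And>x y. x \<in> space M \<Longrightarrow> y \<in> space M \<Longrightarrow> q x = q y \<longleftrightarrow> p x = p y"
  shows "fun_entropy M p = fun_entropy M q"
  by (intro antisym fun_entropy_mono) (use assms in auto)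

end

text \<open>Level sets of \<open>p \<circ> T\<close> are preimages of those of \<open>p\<close> and
  have the same measure by invariance. Since \<open>T\<close> may fail to be onto, \<open>p\<close>
  can take further values; their level sets are null and contribute 0.\<close>

lemma fun_entropy_distr:
  assumes T: "T \<in> measurable M N" and d: "distr M N T = N" and p: "simple_function N p"
  shows "fun_entropy M (p \<circ> T) = fun_entropy N p"
proof -
  have m: "measure M ((p \<circ> T) -` {c} \<inter> space M) = measure N (p -` {c} \<inter> space N)" for c
  proof -
    have s: "p -` {c} \<inter> space N \<in> sets N" using p by (rule simple_functionD(2))
    have "measure N (p -` {c} \<inter> space N) = measure (distr M N T) (p -` {c} \<inter> space N)"
      by (simp add: d)
    also have "\<dots> = measure M (T -` (p -` {c} \<inter> space N) \<inter> space M)"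
      by (rule measure_distr[OF T s])
    also have "T -` (p -` {c} \<inter> space N) \<inter> space M = (p \<circ> T) -` {c} \<inter> space M"
      using measurable_space[OF T] by auto
    finally show ?thesis by simp
  qed
  have sub: "(p \<circ> T) ` space M \<subseteq> p ` space N" using measurable_space[OF T] by auto
  have z: "measure N (p -` {c} \<inter> space N) = 0" if "c \<notin> (p \<circ> T) ` space M" for c
  proof -
    have "(p \<circ> T) -` {c} \<inter> space M = {}" using that by auto
    then show ?thesis using m[of c] by simp
  qed
  show ?thesis unfolding fun_entropy_def m
    by (subst sum.mono_neutral_left[OF simple_functionD(1)[OF p] sub]) (auto simp: z)
qed

text \<open>Joint level sets are rectangles, so their measures factor; the logarithm turns the
  product into a sum, and the other factor sums to 1.\<close>

lemma fun_entropy_pair_measure: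
  assumes "prob_space M" "prob_space N" and p: "simple_function M p" and q: "simple_function N q"
  shows "fun_entropy (M \<Otimes>\<^sub>M N) (\<lambda>z. (p (fst z), q (snd z))) = fun_entropy M p + fun_entropy N q"
proof -
  interpret M: prob_space M by fact
  interpret N: prob_space N by fact
  interpret MN: pair_prob_space M N ..
  let ?a = "\<lambda>c. measure M (p -` {c} \<inter> space M)" and ?b = "\<lambda>c. measure N (q -` {c} \<inter> space N)"
  have img: "(\<lambda>z. (p (fst z), q (snd z))) ` space (M \<Otimes>\<^sub>M N) = p ` space M \<times> q ` space N"
  proof (intro equalityI subsetI)
    fix w assume "w \<in> p ` space M \<times> q ` space N"
    then obtain x y where "x \<in> space M" "y \<in> space N" "w = (p x, q y)" by blast
    then show "w \<in> (\<lambda>z. (p (fst z), q (snd z))) ` space (M \<Otimes>\<^sub>M N)"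
      by (intro image_eqI[of _ _ "(x, y)"]) (simp_all add: space_pair_measure)
  qed (auto simp: space_pair_measure)
  have m: "measure (M \<Otimes>\<^sub>M N) ((\<lambda>z. (p (fst z), q (snd z))) -` {(c, d)} \<inter> space (M \<Otimes>\<^sub>M N)) = ?a c * ?b d"
    for c d
  proof -
    have "(\<lambda>z. (p (fst z), q (snd z))) -` {(c, d)} \<inter> space (M \<Otimes>\<^sub>M N)
        = (p -` {c} \<inter> space M) \<times> (q -` {d} \<inter> space N)"
      by (auto simp: space_pair_measure)
    then show ?thesis
      using N.emeasure_pair_measure_Times[OF simple_functionD(2)[OF p, of "{c}"] simple_functionD(2)[OF q, of "{d}"]]
      by (simp add: measure_def enn2real_mult)
  qed
  have s1: "(\<Sum>c\<in>p ` space M. ?a c) = 1"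
    by (rule M.simple_distributed_sum_space[OF M.simple_distributedI[OF p measure_nonneg refl]])
  have s2: "(\<Sum>c\<in>q ` space N. ?b c) = 1"
    by (rule N.simple_distributed_sum_space[OF N.simple_distributedI[OF q measure_nonneg refl]])
  \<comment> \<open>If \<open>x\<close> or \<open>y\<close> is 0, all terms vanish, whatever the
    value of \<open>ln 0\<close>.\<close>
  have l: "x * y * ln (x * y) = y * (x * ln x) + x * (y * ln y)" if "0 \<le> x" "0 \<le> y" for x y :: real
    using that by (cases "x = 0 \<or> y = 0") (auto simp: ln_mult algebra_simps)
  have "fun_entropy (M \<Otimes>\<^sub>M N) (\<lambda>z. (p (fst z), q (snd z)))
      = - (\<Sum>c\<in>p ` space M. \<Sum>d\<in>q ` space N. ?a c * ?b d * ln (?a c * ?b d))"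
    unfolding fun_entropy_def img sum.cartesian_product by (intro arg_cong[where f=uminus] sum.cong) (auto simp: m)
  also have "\<dots> = - (\<Sum>c\<in>p ` space M. \<Sum>d\<in>q ` space N. ?b d * (?a c * ln (?a c)) + ?a c * (?b d * ln (?b d)))"
    by (simp add: l)
  also have "\<dots> = fun_entropy M p + fun_entropy N q"
    by (simp add: fun_entropy_def sum.distrib sum_distrib_left[symmetric] sum_distrib_right[symmetric] s1 s2)
  finally show ?thesis .
qed

section \<open>Partitions as level sets of finite-valued functions\<close>

text \<open>Hypothesis \<open>k\<close> makes the cells of \<open>R\<close> exactly the nonempty
  level sets of \<open>p\<close>, so both entropies are the same sum.\<close>

lemma partition_entropy_eq_fun_entropy:
  assumes R: "partition_on (space M) R"
    and k: "\<And>x y. x \<in> space M \<Longrightarrow> y \<in> space M \<Longrightarrow> (\<exists>C\<in>R. x \<in> C \<and> y \<in> C) \<longleftrightarrow> p x = p y"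
  shows "partition_entropy M R = fun_entropy M p"
proof -
  let ?h = "\<lambda>c. p -` {c} \<inter> space M"
  have cell: "C = ?h (p x)" if C: "C \<in> R" "x \<in> C" for C x
  proof -
    have sub: "C \<subseteq> space M" using R C by (auto simp: partition_on_def)
    have "y \<in> C" if y: "y \<in> space M" "p y = p x" for y
    proof -
      have "x \<in> space M" using C sub by auto
      then obtain D where "D \<in> R" "x \<in> D" "y \<in> D" using k[of x y] y by auto
      moreover have "D = C"
        using \<open>D \<in> R\<close> \<open>x \<in> D\<close> C partition_onD2[OF R] unfolding disjoint_def by blast
      ultimately show ?thesis by simp
    qed
    moreover have "p y = p x" if "y \<in> C" for y using k[of y x] that C sub by blast
    ultimately show ?thesis using sub by auto
  qed
  have "R = ?h ` p ` space M"
  proof (intro equalityI subsetI)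
    fix C assume C: "C \<in> R"
    then have "C \<noteq> {}" using R by (auto simp: partition_on_def)
    then obtain x where "x \<in> C" by blast
    moreover have "x \<in> space M" using R C \<open>x \<in> C\<close> by (auto simp: partition_on_def)
    ultimately show "C \<in> ?h ` p ` space M" using cell[OF C] by blast
  next
    fix C assume "C \<in> ?h ` p ` space M"
    then obtain x where x: "x \<in> space M" "C = ?h (p x)" by auto
    then obtain D where "D \<in> R" "x \<in> D" using R by (auto simp: partition_on_def)
    then show "C \<in> R" using cell[of D x] x by simp
  qed
  moreover have "inj_on ?h (p ` space M)" by (auto simp: inj_on_def)
  ultimately show ?thesis
    unfolding partition_entropy_def fun_entropy_def by (simp add: sum.reindex)
qed

text \<open>A singleton on the partitioned set; unlike a choice of the cell it needs no junk value elsewhere.\<close>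
definition cells :: "'a set set \<Rightarrow> 'a \<Rightarrow> 'a set set" where
  "cells P x = {A \<in> P. x \<in> A}"

lemma cells_eq:
  assumes "partition_on S P" "A \<in> P" "x \<in> A"
  shows "cells P x = {A}"
  using assms by (auto simp: cells_def partition_on_def disjoint_def)

lemma cells_eq_iff:
  assumes "partition_on S P" "x \<in> S"
  shows "cells P x = cells P y \<longleftrightarrow> (\<exists>A\<in>P. x \<in> A \<and> y \<in> A)"
proof -
  obtain A where A: "A \<in> P" "x \<in> A" using assms by (auto simp: partition_on_def)
  show ?thesis
  proof
    assume "cells P x = cells P y"
    then have "A \<in> cells P y" using A by (auto simp: cells_def)
    then show "\<exists>A\<in>P. x \<in> A \<and> y \<in> A" using A by (auto simp: cells_def)
  next
    assume "\<exists>A\<in>P. x \<in> A \<and> y \<in> A"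
    then obtain B where "B \<in> P" "x \<in> B" "y \<in> B" by blast
    then show "cells P x = cells P y" by (simp add: cells_eq[OF assms(1)])
  qed
qed

lemma simple_function_cells:
  assumes "finite P" "P \<subseteq> sets M"
  shows "simple_function M (cells P)"
proof -
  have "cells P ` space M \<subseteq> Pow P" by (auto simp: cells_def)
  moreover have "cells P -` {c} \<inter> space M \<in> sets M" for c
  proof (cases "c \<subseteq> P")
    case True
    have "cells P x = c \<longleftrightarrow> (\<forall>A\<in>P. x \<in> A \<longleftrightarrow> A \<in> c)" for x
      using True unfolding cells_def set_eq_iff by blast
    \<comment> \<open>A point is outside the level set iff it disagrees with \<open>c\<close> about
      membership in some \<open>A\<close>; the union collects these disagreements.\<close>
    then have "cells P -` {c} \<inter> space M
        = space M - (\<Union>A\<in>P. if A \<in> c then space M - A else A)"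
      by (auto split: if_splits)
    also have "(\<Union>A\<in>P. if A \<in> c then space M - A else A) \<in> sets M"
      by (rule sets.finite_UN) (use assms in auto)
    then have "space M - (\<Union>A\<in>P. if A \<in> c then space M - A else A) \<in> sets M"
      by (rule sets.compl_sets)
    finally show ?thesis .
  next
    case False
    then have "cells P -` {c} \<inter> space M = {}" by (auto simp: cells_def)
    then show ?thesis by simp
  qed
  ultimately show ?thesis
    using assms finite_subset unfolding simple_function_def by blast
qed

section \<open>Joins over time as itineraries\<close>

definition itinerary :: "(nat \<Rightarrow> 'a \<Rightarrow> 'b) \<Rightarrow> (nat \<Rightarrow> 'b \<Rightarrow> 'c) \<Rightarrow> nat \<Rightarrow> 'a \<Rightarrow> 'c list" where
  "itinerary T p n x = map (\<lambda>i. p i (T i x)) [0..<n]"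

lemma itinerary_eq_iff: "itinerary T p n x = itinerary T p n y \<longleftrightarrow> (\<forall>i<n. p i (T i x) = p i (T i y))"
  by (auto simp: itinerary_def)

lemma itinerary_Suc: "itinerary T p (Suc n) x = itinerary T p n x @ [p n (T n x)]"
  by (simp add: itinerary_def)

text \<open>Two points share a cell of the join iff they visit the same cells at all times below
  \<open>n\<close>. With \<open>n > 0\<close> the family of partitions is nonempty, as required for
  its refinement to be a partition.\<close>

lemma partition_entropy_common_refinement:
  assumes n: "n > 0" and P: "\<And>i. i < n \<Longrightarrow> partition_on (Z i) (P i)"
    and T: "\<And>i. i < n \<Longrightarrow> T i \<in> space M \<rightarrow> Z i"
  shows "partition_entropy M (common_refinement ((\<lambda>i. pullback_partition (space M) (T i) (P i)) ` {..<n}))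
      = fun_entropy M (itinerary T (\<lambda>i. cells (P i)) n)"
proof -
  let ?Q = "\<lambda>i. pullback_partition (space M) (T i) (P i)"
  let ?R = "common_refinement (?Q ` {..<n})"
  have Q: "partition_on (space M) (?Q i)" if i: "i < n" for i
    unfolding partition_on_def
  proof (intro conjI)
    show "\<Union> (?Q i) = space M"
    proof (intro equalityI subsetI)
      fix x assume x: "x \<in> space M"
      then obtain A where "A \<in> P i" "T i x \<in> A"
        using P[OF i] T[OF i] by (auto simp: partition_on_def)
      then have "x \<in> T i -` A \<inter> space M" "T i -` A \<inter> space M \<in> ?Q i"
        using x by (auto simp: pullback_partition_def)
      then show "x \<in> \<Union> (?Q i)" by blast
    qed (auto simp: pullback_partition_def)
    show "disjoint (?Q i)"
    proof (rule disjointI)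
      fix B C assume "B \<in> ?Q i" "C \<in> ?Q i" "B \<noteq> C"
      then obtain A A' where A: "A \<in> P i" "A' \<in> P i"
        "B = T i -` A \<inter> space M" "C = T i -` A' \<inter> space M"
        unfolding pullback_partition_def by blast
      then have "A \<noteq> A'" using \<open>B \<noteq> C\<close> by blast
      then have "A \<inter> A' = {}" using partition_onD2[OF P[OF i]] A by (simp add: disjoint_def)
      then show "B \<inter> C = {}" using A by auto
    qed
  qed (auto simp: pullback_partition_def)
  have R: "partition_on (space M) ?R"
    by (rule partition_on_common_refinement) (use Q n in auto)
  show ?thesis
  proof (rule partition_entropy_eq_fun_entropy[OF R])
    fix x y assume xy: "x \<in> space M" "y \<in> space M"
    show "(\<exists>C\<in>?R. x \<in> C \<and> y \<in> C) \<longleftrightarrow>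
      itinerary T (\<lambda>i. cells (P i)) n x = itinerary T (\<lambda>i. cells (P i)) n y"
    proof
      assume "\<exists>C\<in>?R. x \<in> C \<and> y \<in> C"
      then obtain C where C: "C \<in> ?R" "x \<in> C" "y \<in> C" by blast
      have "cells (P i) (T i x) = cells (P i) (T i y)" if i: "i < n" for i
      proof -
        obtain B where "B \<in> ?Q i" "C \<subseteq> B" using common_refinement_exists[OF C(1)] i by blast
        then obtain A where "A \<in> P i" "T i x \<in> A" "T i y \<in> A"
          using C by (auto simp: pullback_partition_def)
        then show ?thesis by (simp add: cells_eq[OF P[OF i]])
      qed
      then show "itinerary T (\<lambda>i. cells (P i)) n x = itinerary T (\<lambda>i. cells (P i)) n y"
        by (simp add: itinerary_eq_iff)
    next
      assume e: "itinerary T (\<lambda>i. cells (P i)) n x = itinerary T (\<lambda>i. cells (P i)) n y"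
      obtain C where C: "C \<in> ?R" "x \<in> C" using R xy by (auto simp: partition_on_def)
      \<comment> \<open>A cell of the refinement is an intersection of one chosen cell per pullback.
        The choice \<open>h\<close> is indexed by the partition, not by the time, so equal pullbacks
        at two times share their cell.\<close>
      then obtain h where h: "h \<in> (\<Pi> B\<in>?Q ` {..<n}. B)" "C = \<Inter> (h ` ?Q ` {..<n})"
        unfolding common_refinement by auto
      have "y \<in> h (?Q i)" if i: "i < n" for i
      proof -
        have "h (?Q i) \<in> ?Q i" "x \<in> h (?Q i)" using h C i by auto
        then obtain A where A: "A \<in> P i" "h (?Q i) = T i -` A \<inter> space M" "T i x \<in> A"
          by (auto simp: pullback_partition_def)
        then have "A \<in> cells (P i) (T i y)" using e i by (auto simp: itinerary_eq_iff cells_def)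
        then show ?thesis using A xy by (auto simp: cells_def)
      qed
      then show "\<exists>C\<in>?R. x \<in> C \<and> y \<in> C" using C h by (intro bexI[of _ C]) auto
    qed
  qed
qed

lemma simple_function_itinerary:
  assumes "\<And>i. i < n \<Longrightarrow> simple_function (N i) (p i)" "\<And>i. i < n \<Longrightarrow> T i \<in> measurable M (N i)"
  shows "simple_function M (itinerary T p n)"
  using assms
proof (induction n)
  case 0
  then show ?case by (simp add: itinerary_def simple_function_def)
next
  case (Suc n)
  have "simple_function M (\<lambda>x. (itinerary T p n x, p n (T n x)))"
    using Suc by (intro simple_function_Pair simple_function_comp[of "T n" M "N n" "p n"]) auto
  from simple_function_compose[OF this, of "\<lambda>(a, b). a @ [b]"]
  show ?case by (simp add: comp_def itinerary_Suc[abs_def])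
qed

context prob_space
begin

text \<open>Each further time costs at most the entropy of \<open>p n \<circ> T n\<close> under
  \<open>M\<close>, which by invariance is that of \<open>p n\<close> under
  \<open>N n\<close>.\<close>

lemma fun_entropy_itinerary_le_sum:
  assumes "\<And>i. i < n \<Longrightarrow> simple_function (N i) (p i)"
    and "\<And>i. i < n \<Longrightarrow> T i \<in> measurable M (N i)"
    and "\<And>i. i < n \<Longrightarrow> distr M (N i) (T i) = N i"
  shows "fun_entropy M (itinerary T p n) \<le> (\<Sum>i<n. fun_entropy (N i) (p i))"
  using assms
proof (induction n)
  case 0
  have "itinerary T p 0 ` space M = {[]}" using not_empty by (auto simp: itinerary_def)
  moreover have "itinerary T p 0 -` {[]} \<inter> space M = space M" by (auto simp: itinerary_def)
  ultimately show ?case by (simp add: fun_entropy_def prob_space)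
next
  case (Suc n)
  have s: "simple_function M (itinerary T p n)" by (rule simple_function_itinerary[where N = N]) (use Suc in auto)
  have s': "simple_function M (\<lambda>x. p n (T n x))"
    by (rule simple_function_comp[where M' = "N n"]) (use Suc in auto)
  have "fun_entropy M (itinerary T p (Suc n)) \<le> fun_entropy M (\<lambda>x. (itinerary T p n x, p n (T n x)))"
    by (rule fun_entropy_mono[OF simple_function_Pair[OF s s']]) (auto simp: itinerary_Suc)
  also have "\<dots> \<le> fun_entropy M (itinerary T p n) + fun_entropy M (\<lambda>x. p n (T n x))"
    by (rule fun_entropy_Pair_le[OF s s'])
  also have "fun_entropy M (\<lambda>x. p n (T n x)) = fun_entropy (N n) (p n)"
    using fun_entropy_distr[of "T n" M "N n" "p n"] Suc.prems by (simp add: comp_def)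
  finally show ?case using Suc.IH Suc.prems by auto
qed

text \<open>If \<open>p\<close> and \<open>r\<close> together determine \<open>q\<close> at each
  time, their itineraries determine that of \<open>q\<close>. In the application \<open>r\<close> is
  a correction of small entropy, so passing from \<open>q\<close> to \<open>p\<close> costs little
  per unit of time.\<close>

lemma fun_entropy_itinerary_le:
  assumes p: "\<And>i. i < n \<Longrightarrow> simple_function (N i) (p i)"
    and r: "\<And>i. i < n \<Longrightarrow> simple_function (N i) (r i)"
    and T: "\<And>i. i < n \<Longrightarrow> T i \<in> measurable M (N i)"
    and d: "\<And>i. i < n \<Longrightarrow> distr M (N i) (T i) = N i"
    and q: "\<And>i x y. \<lbrakk>i < n; x \<in> space (N i); y \<in> space (N i); p i x = p i y; r i x = r i y\<rbrakk> \<Longrightarrow> q i x = q i y"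
  shows "fun_entropy M (itinerary T q n) \<le> fun_entropy M (itinerary T p n) + (\<Sum>i<n. fun_entropy (N i) (r i))"
proof -
  have sp: "simple_function M (itinerary T p n)"
    by (rule simple_function_itinerary[where N = N, OF p T])
  have sr: "simple_function M (itinerary T r n)"
    by (rule simple_function_itinerary[where N = N, OF r T])
  have "fun_entropy M (itinerary T q n) \<le> fun_entropy M (\<lambda>x. (itinerary T p n x, itinerary T r n x))"
  proof (rule fun_entropy_mono[OF simple_function_Pair[OF sp sr]])
    fix x y assume xy: "x \<in> space M" "y \<in> space M"
      and e: "(itinerary T p n x, itinerary T r n x) = (itinerary T p n y, itinerary T r n y)"
    have "q i (T i x) = q i (T i y)" if i: "i < n" for i
    proof (rule q[OF i])
      show "T i x \<in> space (N i)" "T i y \<in> space (N i)"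
        using measurable_space[OF T[OF i]] xy by blast+
      show "p i (T i x) = p i (T i y)" "r i (T i x) = r i (T i y)"
        using e i unfolding prod.inject itinerary_eq_iff by blast+
    qed
    then show "itinerary T q n x = itinerary T q n y" unfolding itinerary_eq_iff by blast
  qed
  also have "\<dots> \<le> fun_entropy M (itinerary T p n) + fun_entropy M (itinerary T r n)"
    by (rule fun_entropy_Pair_le[OF sp sr])
  also have "fun_entropy M (itinerary T r n) \<le> (\<Sum>i<n. fun_entropy (N i) (r i))"
    by (rule fun_entropy_itinerary_le_sum[OF r T d])
  finally show ?thesis by simp
qed

end

text \<open>\<open>- (t * ln t)\<close> tends to 0 at both ends of the unit interval. Both ends are
  needed for a function that is almost surely almost constant: its main value has probability near
  1, all others near 0.\<close>

lemma uminus_mult_ln_small: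
  fixes e :: real
  assumes "e > 0"
  obtains d where "d > 0" "\<And>t. \<lbrakk>0 \<le> t; t \<le> 1; t \<le> d \<or> 1 - d \<le> t\<rbrakk> \<Longrightarrow> - (t * ln t) \<le> e"
proof
  \<comment> \<open>Near 0 the bound is \<open>2 * sqrt t\<close>, at most \<open>e\<close> for
    \<open>t \<le> (e / 2)\<^sup>2\<close>; near 1 it is \<open>1 - t\<close>.\<close>
  let ?d = "min e ((e / 2)\<^sup>2)"
  show "?d > 0" using assms by simp
  fix t :: real assume t: "0 \<le> t" "t \<le> 1" "t \<le> ?d \<or> 1 - ?d \<le> t"
  show "- (t * ln t) \<le> e"
  proof (cases "t = 0")
    case True
    then show ?thesis using assms by simp
  next
    case False
    then have t0: "t > 0" using t(1) by simp
    from t(3) show ?thesis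
    proof
      assume "t \<le> ?d"
      then have "t \<le> (e / 2)\<^sup>2" by simp
      then have s: "sqrt t \<le> e / 2" using assms by (intro real_le_lsqrt) simp_all
      \<comment> \<open>Applying \<open>ln x \<le> x - 1\<close> to \<open>1 / sqrt t\<close>
        instead of \<open>1 / t\<close> leaves a factor \<open>sqrt t\<close> after multiplication
        by \<open>t\<close>.\<close>
      have "- ln (sqrt t) \<le> 1 / sqrt t"
        using ln_le_minus_one[of "1 / sqrt t"] t0 by (simp add: ln_div)
      then have "- ln t \<le> 2 * (1 / sqrt t)" using t0 by (simp add: ln_sqrt)
      then have "t * (- ln t) \<le> t * (2 * (1 / sqrt t))"
        by (rule mult_left_mono) (rule t(1))
      also have "\<dots> = 2 * (t / sqrt t)" by simp
      also have "\<dots> = 2 * sqrt t" by (simp only: real_div_sqrt[OF t(1)])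
      finally show ?thesis using s by simp
    next
      assume "1 - ?d \<le> t"
      then have "1 - t \<le> e" by simp
      have "- ln t \<le> 1 / t - 1" using ln_le_minus_one[of "1 / t"] t0 by (simp add: ln_div)
      then have "t * (- ln t) \<le> t * (1 / t - 1)" by (rule mult_left_mono) (rule t(1))
      also have "\<dots> = 1 - t" using t0 by (simp add: right_diff_distrib)
      finally show ?thesis using \<open>1 - t \<le> e\<close> by simp
    qed
  qed
qed

section \<open>Borel sets of compact metric spaces\<close>

lemma openin_mtopology_of:
  "openin (mtopology_of m) U \<longleftrightarrow>
    U \<subseteq> mspace m \<and> (\<forall>x\<in>U. \<exists>r>0. \<forall>y\<in>mspace m. mdist m x y < r \<longrightarrow> y \<in> U)"
proof -
  interpret Metric_space "mspace m" "mdist m" by simp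
  have "openin mtopology U \<longleftrightarrow>
    U \<subseteq> mspace m \<and> (\<forall>x\<in>U. \<exists>r>0. \<forall>y\<in>mspace m. mdist m x y < r \<longrightarrow> y \<in> U)"
    unfolding openin_mtopology subset_iff in_mball by blast
  then show ?thesis by (simp add: mtopology_of_def)
qed

lemma mdist_self: "x \<in> mspace m \<Longrightarrow> mdist m x x = 0"
  by simp

lemma openin_ball:
  assumes "a \<in> mspace m"
  shows "openin (mtopology_of m) {x \<in> mspace m. mdist m a x < r}"
  unfolding openin_mtopology_of
proof (intro conjI ballI)
  fix x assume x: "x \<in> {x \<in> mspace m. mdist m a x < r}"
  have "mdist m a y < r" if "y \<in> mspace m" "mdist m x y < r - mdist m a x" for y
    using mdist_triangle[of a m x y] assms x that by auto
  then show "\<exists>e>0. \<forall>y\<in>mspace m. mdist m x y < e \<longrightarrow> y \<in> {x \<in> mspace m. mdist m a x < r}"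
    using x by (intro exI[of _ "r - mdist m a x"]) auto
qed auto

text \<open>Balls of the max metric are products of balls of equal radius. The identification makes
  the library's results on compactness in product topologies available.\<close>

lemma mtopology_of_max_metric:
  "mtopology_of (max_metric m1 m2) = prod_topology (mtopology_of m1) (mtopology_of m2)"
  unfolding topology_eq
proof (intro allI iffI)
  fix W assume W: "openin (mtopology_of (max_metric m1 m2)) W"
  show "openin (prod_topology (mtopology_of m1) (mtopology_of m2)) W"
    unfolding openin_prod_topology_alt
  proof (intro allI impI)
    fix x y assume xy: "(x, y) \<in> W"
    then obtain r where r: "r > 0"
      "\<And>z. z \<in> mspace m1 \<times> mspace m2 \<Longrightarrow> max (mdist m1 x (fst z)) (mdist m2 y (snd z)) < r \<Longrightarrow> z \<in> W"
      using W unfolding openin_mtopology_of by fastforce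
    have s: "x \<in> mspace m1" "y \<in> mspace m2" using W xy unfolding openin_mtopology_of by auto
    let ?U = "{x' \<in> mspace m1. mdist m1 x x' < r}" and ?V = "{y' \<in> mspace m2. mdist m2 y y' < r}"
    have "?U \<times> ?V \<subseteq> W" using r(2) by auto
    moreover have "x \<in> ?U" "y \<in> ?V" using s r(1) by (simp_all add: mdist_self)
    ultimately show "\<exists>U V. openin (mtopology_of m1) U \<and> openin (mtopology_of m2) V \<and> x \<in> U \<and> y \<in> V \<and> U \<times> V \<subseteq> W"
      using openin_ball[OF s(1), of r] openin_ball[OF s(2), of r] by (intro exI[of _ ?U] exI[of _ ?V]) simp
  qed
next
  fix W assume W: "openin (prod_topology (mtopology_of m1) (mtopology_of m2)) W"
  have "W \<subseteq> mspace m1 \<times> mspace m2" using openin_subset[OF W] by simp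
  moreover have "\<exists>r>0. \<forall>z\<in>mspace m1 \<times> mspace m2. max (mdist m1 x (fst z)) (mdist m2 y (snd z)) < r \<longrightarrow> z \<in> W"
    if xy: "(x, y) \<in> W" for x y
  proof -
    obtain U V where UV: "openin (mtopology_of m1) U" "openin (mtopology_of m2) V" "x \<in> U" "y \<in> V" "U \<times> V \<subseteq> W"
      using W[unfolded openin_prod_topology_alt, rule_format, OF xy] by (elim exE conjE)
    obtain r where r: "r > 0" "\<And>x'. x' \<in> mspace m1 \<Longrightarrow> mdist m1 x x' < r \<Longrightarrow> x' \<in> U"
      using UV(1,3) unfolding openin_mtopology_of by meson
    obtain s where s: "s > 0" "\<And>y'. y' \<in> mspace m2 \<Longrightarrow> mdist m2 y y' < s \<Longrightarrow> y' \<in> V"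
      using UV(2,4) unfolding openin_mtopology_of by meson
    show ?thesis
    proof (intro exI[of _ "min r s"] conjI ballI impI)
      fix z assume "z \<in> mspace m1 \<times> mspace m2" "max (mdist m1 x (fst z)) (mdist m2 y (snd z)) < min r s"
      then have "fst z \<in> U" "snd z \<in> V" using r s by auto
      then have "z \<in> U \<times> V" by (simp add: mem_Times_iff)
      then show "z \<in> W" using UV(5) by blast
    qed (use r s in simp)
  qed
  ultimately show "openin (mtopology_of (max_metric m1 m2)) W"
    unfolding openin_mtopology_of by (auto split: prod.splits)
qed

lemma mborel_opens: "{U. openin (mtopology_of m) U} \<subseteq> Pow (mspace m)"
  by (auto simp: openin_mtopology_of)

lemma space_mborel [simp]: "space (mborel m) = mspace m"
  unfolding mborel_def by (rule space_measure_of[OF mborel_opens])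

lemma sets_mborel: "sets (mborel m) = sigma_sets (mspace m) {U. openin (mtopology_of m) U}"
  unfolding mborel_def by (rule sets_measure_of[OF mborel_opens])

lemma openin_in_mborel: "openin (mtopology_of m) U \<Longrightarrow> U \<in> sets (mborel m)"
  unfolding sets_mborel by (rule sigma_sets.Basic) simp

lemma closedin_in_mborel: "closedin (mtopology_of m) F \<Longrightarrow> F \<in> sets (mborel m)"
  using openin_in_mborel[of m "mspace m - F"] sets.compl_sets[of "mspace m - F" "mborel m"]
  by (auto simp: closedin_def double_diff)

lemma compactin_in_mborel:
  assumes "compactin (mtopology_of m) K"
  shows "K \<in> sets (mborel m)"
proof -
  have "Hausdorff_space (mtopology_of m)"
    using Metric_space.Hausdorff_space_mtopology[OF Metric_space_mspace_mdist] by (simp add: mtopology_of_def)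
  then show ?thesis using assms by (intro closedin_in_mborel compactin_imp_closedin)
qed

lemma continuous_map_mborel:
  assumes "continuous_map (mtopology_of m1) (mtopology_of m2) f"
  shows "f \<in> measurable (mborel m1) (mborel m2)"
  unfolding mborel_def[of m2]
proof (rule measurable_measure_of[OF mborel_opens])
  show "f \<in> space (mborel m1) \<rightarrow> mspace m2"
    using assms by (auto simp: continuous_map_def)
  fix U assume "U \<in> {U. openin (mtopology_of m2) U}"
  then have "openin (mtopology_of m1) {x \<in> mspace m1. f x \<in> U}"
    using assms by (auto simp: continuous_map_def)
  moreover have "f -` U \<inter> space (mborel m1) = {x \<in> mspace m1. f x \<in> U}" by auto
  ultimately show "f -` U \<inter> space (mborel m1) \<in> sets (mborel m1)"
    using openin_in_mborel by metis
qed

lemma compact_space_finite_net: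
  assumes "compact_space (mtopology_of m)" "r > 0"
  obtains N where "finite N" "N \<subseteq> mspace m" "\<And>x. x \<in> mspace m \<Longrightarrow> \<exists>a\<in>N. mdist m a x < r"
proof -
  interpret Metric_space "mspace m" "mdist m" by simp
  have "mtotally_bounded (mspace m)"
    using assms(1) by (simp add: mtopology_of_def compact_space_eq_mcomplete_mtotally_bounded)
  then have "\<exists>N. finite N \<and> N \<subseteq> mspace m \<and> mspace m \<subseteq> (\<Union>x\<in>N. mball x r)"
    using assms(2) by (simp add: mtotally_bounded_def)
  then obtain N where N: "finite N" "N \<subseteq> mspace m" "mspace m \<subseteq> (\<Union>x\<in>N. mball x r)"
    by (elim exE conjE)
  show ?thesis
  proof (rule that[OF N(1,2)])
    fix x assume "x \<in> mspace m"
    then obtain a where "a \<in> N" "x \<in> mball a r" using N(3) by blast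
    then show "\<exists>a\<in>N. mdist m a x < r" by auto
  qed
qed

text \<open>Compactness gives a finite net at each scale \<open>1 / (k + 1)\<close>, so an open set
  is a countable union of products of balls around net points.\<close>

lemma openin_max_metric_in_pair:
  assumes c1: "compact_space (mtopology_of m1)" and c2: "compact_space (mtopology_of m2)"
    and W: "openin (mtopology_of (max_metric m1 m2)) W"
  shows "W \<in> sets (mborel m1 \<Otimes>\<^sub>M mborel m2)"
proof -
  let ?r = "\<lambda>k. inverse (real (Suc k))"
  have "\<forall>k. \<exists>N. finite N \<and> N \<subseteq> mspace m1 \<and> (\<forall>x\<in>mspace m1. \<exists>a\<in>N. mdist m1 a x < ?r k)"
    by (rule allI, rule compact_space_finite_net[OF c1]) auto
  then obtain N1 where N1: "\<And>k. finite (N1 k)" "\<And>k. N1 k \<subseteq> mspace m1"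
    "\<And>k x. x \<in> mspace m1 \<Longrightarrow> \<exists>a\<in>N1 k. mdist m1 a x < ?r k" by metis
  have "\<forall>k. \<exists>N. finite N \<and> N \<subseteq> mspace m2 \<and> (\<forall>x\<in>mspace m2. \<exists>a\<in>N. mdist m2 a x < ?r k)"
    by (rule allI, rule compact_space_finite_net[OF c2]) auto
  then obtain N2 where N2: "\<And>k. finite (N2 k)" "\<And>k. N2 k \<subseteq> mspace m2"
    "\<And>k x. x \<in> mspace m2 \<Longrightarrow> \<exists>a\<in>N2 k. mdist m2 a x < ?r k" by metis
  define B where "B k p = {x \<in> mspace m1. mdist m1 (fst p) x < ?r k} \<times> {y \<in> mspace m2. mdist m2 (snd p) y < ?r k}"
    for k p
  have "W = (\<Union>k. \<Union>p\<in>{p \<in> N1 k \<times> N2 k. B k p \<subseteq> W}. B k p)"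
  proof (intro equalityI subsetI)
    fix w assume w: "w \<in> W"
    then have s: "fst w \<in> mspace m1" "snd w \<in> mspace m2"
      using W by (auto simp: openin_mtopology_of)
    obtain e where e: "e > 0"
      "\<And>z. z \<in> mspace m1 \<times> mspace m2 \<Longrightarrow> max (mdist m1 (fst w) (fst z)) (mdist m2 (snd w) (snd z)) < e \<Longrightarrow> z \<in> W"
      using W w unfolding openin_mtopology_of by fastforce
    \<comment> \<open>Half of \<open>e\<close>, since a point of the rectangle is reached from
      \<open>w\<close> through the centre, with one radius for each leg.\<close>
    obtain k where k: "?r k < e / 2" using reals_Archimedean[of "e / 2"] e(1) by auto
    obtain a b where ab: "a \<in> N1 k" "b \<in> N2 k" "mdist m1 a (fst w) < ?r k" "mdist m2 b (snd w) < ?r k"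
      using N1(3) N2(3) s by meson
    have ms: "a \<in> mspace m1" "b \<in> mspace m2" using ab N1(2) N2(2) by blast+
    have "B k (a, b) \<subseteq> W"
    proof
      fix z assume "z \<in> B k (a, b)"
      then have z: "fst z \<in> mspace m1" "snd z \<in> mspace m2" "mdist m1 a (fst z) < ?r k" "mdist m2 b (snd z) < ?r k"
        by (auto simp: B_def)
      have "mdist m1 (fst w) (fst z) < e" "mdist m2 (snd w) (snd z) < e"
        using mdist_triangle[of "fst w" m1 a "fst z"] mdist_triangle[of "snd w" m2 b "snd z"]
          s ms z ab k mdist_commute[of m1 a "fst w"] mdist_commute[of m2 b "snd w"] by linarith+
      then show "z \<in> W" using e(2)[of z] z by (simp add: mem_Times_iff)
    qed
    moreover have "w \<in> B k (a, b)" using ab s by (auto simp: B_def mem_Times_iff)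
    ultimately show "w \<in> (\<Union>k. \<Union>p\<in>{p \<in> N1 k \<times> N2 k. B k p \<subseteq> W}. B k p)" using ab by blast
  qed auto
  moreover have "B k p \<in> sets (mborel m1 \<Otimes>\<^sub>M mborel m2)" if "p \<in> N1 k \<times> N2 k" for k p
  proof -
    have "fst p \<in> mspace m1" "snd p \<in> mspace m2" using that N1(2)[of k] N2(2)[of k] by auto
    then show ?thesis unfolding B_def by (intro pair_measureI openin_in_mborel openin_ball)
  qed
  then have "(\<Union>k. \<Union>p\<in>{p \<in> N1 k \<times> N2 k. B k p \<subseteq> W}. B k p) \<in> sets (mborel m1 \<Otimes>\<^sub>M mborel m2)"
    using N1(1) N2(1) by (intro sets.countable_nat_UN image_subsetI sets.finite_UN) auto
  ultimately show ?thesis by simp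
qed

text \<open>Open sets lie in the product sigma-algebra by compactness; conversely, the projections
  are continuous and hence Borel.\<close>

lemma sets_mborel_max_metric:
  assumes c1: "compact_space (mtopology_of m1)" and c2: "compact_space (mtopology_of m2)"
  shows "sets (mborel (max_metric m1 m2)) = sets (mborel m1 \<Otimes>\<^sub>M mborel m2)"
proof
  have "sigma_sets (space (mborel m1 \<Otimes>\<^sub>M mborel m2)) {U. openin (mtopology_of (max_metric m1 m2)) U}
      \<subseteq> sets (mborel m1 \<Otimes>\<^sub>M mborel m2)"
    by (rule sets.sigma_sets_subset) (use openin_max_metric_in_pair[OF assms] in auto)
  then show "sets (mborel (max_metric m1 m2)) \<subseteq> sets (mborel m1 \<Otimes>\<^sub>M mborel m2)"
    by (simp add: sets_mborel space_pair_measure)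
next
  have "(\<lambda>z. (fst z, snd z)) \<in> measurable (mborel (max_metric m1 m2)) (mborel m1 \<Otimes>\<^sub>M mborel m2)"
    by (intro measurable_Pair continuous_map_mborel)
       (simp_all add: mtopology_of_max_metric continuous_map_fst continuous_map_snd)
  then have m: "(\<lambda>z. z) \<in> measurable (mborel (max_metric m1 m2)) (mborel m1 \<Otimes>\<^sub>M mborel m2)"
    by simp
  show "sets (mborel m1 \<Otimes>\<^sub>M mborel m2) \<subseteq> sets (mborel (max_metric m1 m2))"
  proof
    fix A assume A: "A \<in> sets (mborel m1 \<Otimes>\<^sub>M mborel m2)"
    have "A \<subseteq> mspace m1 \<times> mspace m2" using sets.sets_into_space[OF A] by (simp add: space_pair_measure)
    then show "A \<in> sets (mborel (max_metric m1 m2))"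
      using measurable_sets[OF m A] by (simp add: Int_absorb2)
  qed
qed

section \<open>Regularity of Borel measures and separation of compact sets\<close>

lemma closedin_away:
  "closedin (mtopology_of m) {x \<in> mspace m. \<forall>y\<in>C. mdist m x y \<ge> r}" if C: "C \<subseteq> mspace m"
proof -
  have "openin (mtopology_of m) (\<Union>y\<in>C. {x \<in> mspace m. mdist m y x < r})"
  proof (rule openin_Union)
    fix V assume "V \<in> (\<lambda>y. {x \<in> mspace m. mdist m y x < r}) ` C"
    then obtain y where "y \<in> C" "V = {x \<in> mspace m. mdist m y x < r}" by blast
    then show "openin (mtopology_of m) V" using C openin_ball[of y m r] by blast
  qed
  moreover have "mspace m - {x \<in> mspace m. \<forall>y\<in>C. mdist m x y \<ge> r} = (\<Union>y\<in>C. {x \<in> mspace m. mdist m y x < r})"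
    by (auto simp: mdist_commute not_le)
  ultimately show ?thesis by (simp add: closedin_def)
qed

text \<open>The points at distance at least \<open>1 / (n + 1)\<close> from the complement of
  \<open>U\<close> form closed sets increasing to \<open>U\<close>; continuity from below does the
  rest.\<close>

lemma openin_closedin_approx:
  assumes "finite_measure M" and sp: "space M = mspace m" and st: "sets M = sets (mborel m)"
    and U: "openin (mtopology_of m) U" and e: "e > 0"
  shows "\<exists>F. closedin (mtopology_of m) F \<and> F \<subseteq> U \<and> measure M (U - F) < e"
proof -
  interpret finite_measure M by fact
  define F where "F n = {x \<in> mspace m. \<forall>y\<in>mspace m - U. mdist m x y \<ge> inverse (real (Suc n))}" for n
  have Uin: "U \<in> sets M" using openin_in_mborel[OF U] st by simp
  have cl: "closedin (mtopology_of m) (F n)" for n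
    unfolding F_def by (rule closedin_away) auto
  have Fin: "F n \<in> sets M" for n using closedin_in_mborel[OF cl] st by simp
  have sub: "F n \<subseteq> U" for n
  proof
    fix x assume x: "x \<in> F n"
    show "x \<in> U"
    proof (rule ccontr)
      assume "x \<notin> U"
      then have "inverse (real (Suc n)) \<le> mdist m x x" using x by (auto simp: F_def)
      moreover have "mdist m x x = 0" using x by (simp add: F_def)
      ultimately show False by simp
    qed
  qed
  have inc: "incseq F"
  proof (rule incseq_SucI)
    fix n
    have "inverse (real (Suc (Suc n))) \<le> inverse (real (Suc n))" by (simp add: field_simps)
    then show "F n \<subseteq> F (Suc n)" unfolding F_def by (blast intro: order_trans)
  qed
  have un: "(\<Union>n. F n) = U"
  proof (intro equalityI subsetI)
    fix x assume x: "x \<in> U"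
    then obtain r where r: "r > 0" "\<And>y. y \<in> mspace m \<Longrightarrow> mdist m x y < r \<Longrightarrow> y \<in> U"
      using U unfolding openin_mtopology_of by blast
    obtain n where n: "inverse (real (Suc n)) < r" using reals_Archimedean[OF r(1)] by auto
    have "mdist m x y \<ge> inverse (real (Suc n))" if "y \<in> mspace m - U" for y
      using r(2)[of y] that n by (cases "mdist m x y < r") auto
    moreover have "x \<in> mspace m" using x U by (auto simp: openin_mtopology_of)
    ultimately show "x \<in> (\<Union>n. F n)" by (auto simp: F_def)
  qed (use sub in blast)
  have "(\<lambda>n. measure M (F n)) \<longlonglongrightarrow> measure M U"
    using finite_Lim_measure_incseq[of F] Fin inc un by auto
  then have "(\<lambda>n. measure M U - measure M (F n)) \<longlonglongrightarrow> measure M U - measure M U"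
    by (intro tendsto_intros)
  then have "eventually (\<lambda>n. measure M U - measure M (F n) < e) sequentially"
    using e by (intro order_tendstoD(2)) auto
  then obtain n where "measure M U - measure M (F n) < e" by (auto simp: eventually_sequentially)
  moreover have "measure M (U - F n) = measure M U - measure M (F n)"
    by (rule finite_measure_Diff[OF Uin Fin sub])
  ultimately show ?thesis using cl sub by (intro exI[of _ "F n"]) simp
qed

text \<open>The approximation is two-sided to survive the induction over the sigma-algebra: taking
  complements exchanges the closed inner and the open outer set.\<close>

lemma borel_closedin_openin_approx:
  assumes fm: "finite_measure M" and sp: "space M = mspace m" and st: "sets M = sets (mborel m)"
    and A: "A \<in> sets M" and e: "e > 0"
  shows "\<exists>F U. closedin (mtopology_of m) F \<and> openin (mtopology_of m) U \<and> F \<subseteq> A \<and> A \<subseteq> U \<and> measure M (U - F) < e"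
proof -
  interpret finite_measure M by fact
  have "A \<in> sigma_sets (mspace m) {U. openin (mtopology_of m) U}" using A st sets_mborel by auto
  then show ?thesis using e
  proof (induction A arbitrary: e)
    case (Basic U)
    then show ?case using openin_closedin_approx[OF fm sp st, of U e] by blast
  next
    case Empty
    then show ?case by (intro exI[of _ "{}"]) auto
  next
    case (Compl A)
    obtain F U where FU: "closedin (mtopology_of m) F" "openin (mtopology_of m) U" "F \<subseteq> A" "A \<subseteq> U"
      "measure M (U - F) < e" using Compl.IH[OF Compl.prems] by blast
    have "(mspace m - F) - (mspace m - U) = U - F" using FU(2) by (auto simp: openin_mtopology_of)
    moreover have "closedin (mtopology_of m) (mspace m - U)" "openin (mtopology_of m) (mspace m - F)"
      using FU by (auto simp: closedin_def double_diff openin_mtopology_of)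
    ultimately show ?case using FU by (intro exI[of _ "mspace m - U"] exI[of _ "mspace m - F"]) auto
  next
    case (Union A)
    \<comment> \<open>The errors of the single sets add up to \<open>e / 2\<close>; the other half
      pays for truncating the union of closed sets.\<close>
    define c where "c i = e / 2 * (1 / 2) ^ Suc i" for i :: nat
    have c: "c i > 0" for i using Union.prems by (simp add: c_def)
    have "\<forall>i. \<exists>F U. closedin (mtopology_of m) F \<and> openin (mtopology_of m) U \<and> F \<subseteq> A i \<and> A i \<subseteq> U \<and> measure M (U - F) < c i"
      using Union.IH c by blast
    then obtain F U where FU: "\<And>i. closedin (mtopology_of m) (F i)" "\<And>i. openin (mtopology_of m) (U i)"
      "\<And>i. F i \<subseteq> A i" "\<And>i. A i \<subseteq> U i" "\<And>i. measure M (U i - F i) < c i" by metis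
    have Fm: "F i \<in> sets M" for i using closedin_in_mborel[OF FU(1)] st by simp
    have Um: "U i \<in> sets M" for i using openin_in_mborel[OF FU(2)] st by simp
    let ?G = "\<Union>i. F i" and ?U = "\<Union>i. U i"
    \<comment> \<open>The infinite union of the \<open>F i\<close> need not be closed, so a finite
      part of nearly full measure replaces it.\<close>
    define H where "H n = (\<Union>i\<le>n. F i)" for n
    have Hm: "H n \<in> sets M" for n unfolding H_def using Fm by auto
    have Gm: "?G \<in> sets M" "?U \<in> sets M" using Fm Um by auto
    have cs: "c sums (e / 2)"
      using sums_mult[OF power_half_series, of "e / 2"] by (simp add: c_def[abs_def])
    have sm: "summable (\<lambda>i. measure M (U i - F i))"
      by (rule summable_comparison_test'[OF sums_summable[OF cs], of 0]) (use FU(5) less_imp_le in auto)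
    have "measure M (?U - ?G) \<le> measure M (\<Union>i. U i - F i)"
      by (rule finite_measure_mono) (use Fm Um in auto)
    also have "\<dots> \<le> (\<Sum>i. measure M (U i - F i))"
      by (rule finite_measure_subadditive_countably[OF _ sm]) (use Fm Um in auto)
    also have "\<dots> \<le> (\<Sum>i. c i)"
      by (rule suminf_le[OF _ sm sums_summable[OF cs]]) (use FU(5) less_imp_le in auto)
    also have "\<dots> = e / 2" using cs by (rule sums_unique[symmetric])
    finally have 1: "measure M (?U - ?G) \<le> e / 2" .
    have "(\<lambda>n. measure M (H n)) \<longlonglongrightarrow> measure M (\<Union>n. H n)"
    proof (rule finite_Lim_measure_incseq)
      show "incseq H" unfolding H_def by (intro incseq_SucI UN_mono) auto
    qed (use Hm in auto)
    also have "(\<Union>n. H n) = ?G" by (auto simp: H_def)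
    finally have "(\<lambda>n. measure M ?G - measure M (H n)) \<longlonglongrightarrow> measure M ?G - measure M ?G"
      by (intro tendsto_intros)
    then have "eventually (\<lambda>n. measure M ?G - measure M (H n) < e / 2) sequentially"
      using Union.prems by (intro order_tendstoD(2)) auto
    then obtain n where n: "measure M ?G - measure M (H n) < e / 2" by (auto simp: eventually_sequentially)
    have Hs: "H n \<subseteq> ?G" by (auto simp: H_def)
    have "measure M (?U - H n) \<le> measure M ((?U - ?G) \<union> (?G - H n))"
      by (rule finite_measure_mono) (use Gm Hm in auto)
    also have "\<dots> \<le> measure M (?U - ?G) + measure M (?G - H n)"
      by (rule measure_Un_le) (use Gm Hm in auto)
    also have "measure M (?G - H n) = measure M ?G - measure M (H n)"
      by (rule finite_measure_Diff[OF Gm(1) Hm Hs])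
    finally have "measure M (?U - H n) < e" using 1 n by linarith
    moreover have "closedin (mtopology_of m) (H n)"
      unfolding H_def by (rule closedin_Union) (use FU in auto)
    moreover have "openin (mtopology_of m) ?U" by (rule openin_Union) (use FU in auto)
    moreover have "H n \<subseteq> (\<Union>i. A i)" "(\<Union>i. A i) \<subseteq> ?U" using FU(3,4) unfolding H_def by blast+
    ultimately show ?case by blast
  qed
qed

text \<open>In a compact space the closed inner set is compact; the open outer set only serves to
  bound the defect.\<close>

lemma compactin_inner_approx:
  assumes fm: "finite_measure M" and sp: "space M = mspace m" and st: "sets M = sets (mborel m)"
    and c: "compact_space (mtopology_of m)" and A: "A \<in> sets M" and e: "e > 0"
  obtains K where "compactin (mtopology_of m) K" "K \<subseteq> A" "measure M (A - K) \<le> e"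
proof -
  interpret finite_measure M by fact
  obtain F U where FU: "closedin (mtopology_of m) F" "openin (mtopology_of m) U" "F \<subseteq> A" "A \<subseteq> U" "measure M (U - F) < e"
    using borel_closedin_openin_approx[OF fm sp st A e] by blast
  have "measure M (A - F) \<le> measure M (U - F)"
    by (rule finite_measure_mono) (use FU openin_in_mborel[OF FU(2)] closedin_in_mborel[OF FU(1)] st in auto)
  then show ?thesis using that[of F] FU closedin_compact_space[OF c FU(1)] by simp
qed

lemma compactin_separated:
  assumes K: "compactin (mtopology_of m) K" and L: "compactin (mtopology_of m) L" and disj: "K \<inter> L = {}"
  shows "\<exists>d>0. \<forall>x\<in>K. \<forall>y\<in>L. mdist m x y \<ge> d"
proof -
  have "Hausdorff_space (mtopology_of m)"
    using Metric_space.Hausdorff_space_mtopology[OF Metric_space_mspace_mdist] by (simp add: mtopology_of_def)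
  then have "closedin (mtopology_of m) L" using L by (rule compactin_imp_closedin)
  then have op: "openin (mtopology_of m) (mspace m - L)" and Ls: "L \<subseteq> mspace m" by (auto simp: closedin_def)
  have Ks: "K \<subseteq> mspace m" using compactin_subset_topspace[OF K] by simp
  have "\<exists>r>0. \<forall>y\<in>L. mdist m x y \<ge> r" if x: "x \<in> K" for x
  proof -
    have "x \<in> mspace m - L" using x disj Ks by blast
    then obtain r where "r > 0" "\<forall>y\<in>mspace m. mdist m x y < r \<longrightarrow> y \<in> mspace m - L"
      using op unfolding openin_mtopology_of by meson
    then show ?thesis using Ls by (intro exI[of _ r]) force
  qed
  then obtain r where r: "\<And>x. x \<in> K \<Longrightarrow> r x > 0" "\<And>x y. x \<in> K \<Longrightarrow> y \<in> L \<Longrightarrow> mdist m x y \<ge> r x"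
    by metis
  let ?B = "\<lambda>x. {y \<in> mspace m. mdist m x y < r x / 2}"
  have op_B: "openin (mtopology_of m) U" if U: "U \<in> ?B ` K" for U
  proof -
    from U obtain x where "x \<in> K" "U = ?B x" by blast
    then show "openin (mtopology_of m) U" using Ks openin_ball[of x m "r x / 2"] by blast
  qed
  have cover: "K \<subseteq> \<Union> (?B ` K)"
  proof
    fix x assume x: "x \<in> K"
    then have "x \<in> ?B x" using Ks r(1)[OF x] by (auto simp: subset_iff mdist_self)
    then show "x \<in> \<Union> (?B ` K)" using x by blast
  qed
  obtain \<F> where \<F>: "finite \<F>" "\<F> \<subseteq> ?B ` K" "K \<subseteq> \<Union> \<F>"
    using compactinD[OF K _ cover, OF op_B] by auto
  obtain F where F: "finite F" "F \<subseteq> K" "\<F> = ?B ` F"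
    using finite_subset_image[OF \<F>(1,2)] by auto
  \<comment> \<open>The element 1 keeps \<open>Min\<close> meaningful and positive when
    \<open>K\<close>, and so possibly \<open>F\<close>, is empty.\<close>
  define d where "d = Min (insert 1 ((\<lambda>x. r x / 2) ` F))"
  have fin: "finite (insert 1 ((\<lambda>x. r x / 2) ` F))" using F(1) by simp
  have "d > 0" unfolding d_def using F(2) r(1) by (subst Min_gr_iff[OF fin]) auto
  moreover have "mdist m x y \<ge> d" if x: "x \<in> K" and y: "y \<in> L" for x y
  proof -
    obtain z where z: "z \<in> F" "mdist m z x < r z / 2" using \<F>(3) F(3) x by blast
    have zK: "z \<in> K" using z F(2) by blast
    have "d \<le> r z / 2" unfolding d_def by (rule Min_le[OF fin]) (use z(1) in blast)
    moreover have "mdist m z y \<le> mdist m z x + mdist m x y"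
      by (rule mdist_triangle) (use x y zK Ks Ls in blast)+
    ultimately show ?thesis using r(2)[OF zK y] z(2) by linarith
  qed
  ultimately show ?thesis by blast
qed

section \<open>Comparison with fine partition sequences\<close>

lemma topological_nds_continuous_map:
  assumes "topological_nds X f"
  shows "continuous_map (mtopology_of (X n)) (mtopology_of (X (Suc n))) (f n)"
  unfolding continuous_map_def
proof (intro conjI allI impI)
  have fs: "f n \<in> mspace (X n) \<rightarrow> mspace (X (Suc n))"
    using assms by (simp add: topological_nds_def)
  then show "f n \<in> topspace (mtopology_of (X n)) \<rightarrow> topspace (mtopology_of (X (Suc n)))" by simp
  fix U assume U: "openin (mtopology_of (X (Suc n))) U"
  show "openin (mtopology_of (X n)) {x \<in> topspace (mtopology_of (X n)). f n x \<in> U}"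
    unfolding openin_mtopology_of topspace_mtopology_of
  proof (intro conjI ballI)
    fix x assume x: "x \<in> {x \<in> mspace (X n). f n x \<in> U}"
    then have "\<exists>r>0. \<forall>y\<in>mspace (X (Suc n)). mdist (X (Suc n)) (f n x) y < r \<longrightarrow> y \<in> U"
      using U unfolding openin_mtopology_of by simp
    then obtain r where r: "r > 0" "\<And>y. y \<in> mspace (X (Suc n)) \<Longrightarrow> mdist (X (Suc n)) (f n x) y < r \<Longrightarrow> y \<in> U"
      by auto
    have "\<exists>\<delta>>0. \<forall>n. \<forall>x\<in>mspace (X n). \<forall>y\<in>mspace (X n).
        mdist (X n) x y < \<delta> \<longrightarrow> mdist (X (Suc n)) (f n x) (f n y) < r"
      using assms r(1) by (simp add: topological_nds_def)
    then obtain d where d: "d > 0" "\<And>y. y \<in> mspace (X n) \<Longrightarrow> mdist (X n) x y < d \<Longrightarrow>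
        mdist (X (Suc n)) (f n x) (f n y) < r" using x by auto
    show "\<exists>r>0. \<forall>y\<in>mspace (X n). mdist (X n) x y < r \<longrightarrow> y \<in> {x \<in> mspace (X n). f n x \<in> U}"
    proof (intro exI[of _ d] conjI ballI impI)
      fix y assume y: "y \<in> mspace (X n)" "mdist (X n) x y < d"
      then have "f n y \<in> mspace (X (Suc n))" using fs by auto
      then have "f n y \<in> U" using r(2) d(2)[OF y] by simp
      then show "y \<in> {x \<in> mspace (X n). f n x \<in> U}" using y by simp
    qed (rule d(1))
  qed auto
qed

locale nds_ims =
  fixes X :: "nat \<Rightarrow> 'a metric" and f :: "nat \<Rightarrow> 'a \<Rightarrow> 'a" and \<mu> :: "nat \<Rightarrow> 'a measure"
  assumes nds: "topological_nds X f" and ims: "ims X f \<mu>"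
begin

lemma prob_space_ims: "prob_space (\<mu> n)"
  and space_ims: "space (\<mu> n) = mspace (X n)"
  and sets_ims: "sets (\<mu> n) = sets (mborel (X n))"
  and distr_ims: "distr (\<mu> n) (\<mu> (Suc n)) (f n) = \<mu> (Suc n)"
  using ims by (simp_all add: ims_def)

lemma compact_nds: "compact_space (mtopology_of (X n))"
  using nds by (simp add: topological_nds_def)

lemma measurable_nds: "f n \<in> measurable (\<mu> n) (\<mu> (Suc n))"
  using continuous_map_mborel[OF topological_nds_continuous_map[OF nds]]
  by (simp cong: measurable_cong_sets add: sets_ims)

lemma measurable_nds_iter: "nds_iter f 0 n \<in> measurable (\<mu> 0) (\<mu> n)"
proof (induction n)
  case (Suc n)
  then show ?case using measurable_comp[OF Suc measurable_nds[of n]] by (simp add: comp_def)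
qed (simp add: id_def)

lemma distr_nds_iter: "distr (\<mu> 0) (\<mu> n) (nds_iter f 0 n) = \<mu> n"
proof (induction n)
  case 0
  then show ?case by (simp add: id_def distr_id)
next
  case (Suc n)
  have "distr (\<mu> 0) (\<mu> (Suc n)) (nds_iter f 0 (Suc n)) = distr (distr (\<mu> 0) (\<mu> n) (nds_iter f 0 n)) (\<mu> (Suc n)) (f n)"
    by (simp add: distr_distr[OF measurable_nds measurable_nds_iter])
  also have "\<dots> = \<mu> (Suc n)" by (simp only: Suc distr_ims)
  finally show ?case .
qed

lemma simple_function_cells_ims:
  assumes "borel_partition (X n) P"
  shows "simple_function (\<mu> n) (cells P)"
  using assms by (intro simple_function_cells) (auto simp: borel_partition_def sets_ims)

end

text \<open>The entropy of the join of the pulled-back partitions over the times below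
  \<open>n\<close>. Itineraries also give it a sensible value at \<open>n = 0\<close>, the entropy
  of a constant function.\<close>

definition block_entropy ::
    "(nat \<Rightarrow> 'a \<Rightarrow> 'a) \<Rightarrow> (nat \<Rightarrow> 'a measure) \<Rightarrow> (nat \<Rightarrow> 'a set set) \<Rightarrow> nat \<Rightarrow> real" where
  "block_entropy f \<mu> P n = fun_entropy (\<mu> 0) (itinerary (nds_iter f 0) (\<lambda>i. cells (P i)) n)"

context nds_ims
begin

lemma block_entropy_nonneg: "0 \<le> block_entropy f \<mu> P n"
  unfolding block_entropy_def by (rule prob_space.fun_entropy_nonneg[OF prob_space_ims])

lemma simple_function_itinerary_cells:
  assumes "\<And>n. borel_partition (X n) (P n)"
  shows "simple_function (\<mu> 0) (itinerary (nds_iter f 0) (\<lambda>i. cells (P i)) n)"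
  by (rule simple_function_itinerary[where N = \<mu>])
     (rule simple_function_cells_ims[OF assms], rule measurable_nds_iter)

lemma partition_entropy_eq_block_entropy:
  assumes P: "\<And>n. borel_partition (X n) (P n)" and n: "n > 0"
  shows "partition_entropy (\<mu> 0)
      (common_refinement ((\<lambda>i. pullback_partition (mspace (X 0)) (nds_iter f 0 i) (P i)) ` {..<n}))
    = block_entropy f \<mu> P n"
proof -
  have "nds_iter f 0 i \<in> space (\<mu> 0) \<rightarrow> mspace (X i)" for i
    using measurable_space[OF measurable_nds_iter] by (auto simp: space_ims)
  moreover have "partition_on (mspace (X i)) (P i)" for i using P by (simp add: borel_partition_def)
  ultimately show ?thesis
    using partition_entropy_common_refinement[OF n, of "\<lambda>i. mspace (X i)" P "nds_iter f 0" "\<mu> 0"]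
    by (simp add: block_entropy_def space_ims)
qed

lemma nds_entropy_partition_eq:
  assumes "\<And>n. borel_partition (X n) (P n)"
  shows "nds_entropy_partition X f \<mu> P = limsup (\<lambda>n. ereal (1 / real n * block_entropy f \<mu> P n))"
  unfolding nds_entropy_partition_def
proof (intro arg_cong[where f = limsup] ext)
  fix n
  show "ereal (1 / real n * partition_entropy (\<mu> 0)
      (common_refinement ((\<lambda>i. pullback_partition (mspace (X 0)) (nds_iter f 0 i) (P i)) ` {..<n})))
    = ereal (1 / real n * block_entropy f \<mu> P n)"
    \<comment> \<open>At \<open>n = 0\<close> both averages are 0 because
      \<open>1 / 0 = 0\<close>.\<close>
    using partition_entropy_eq_block_entropy[of P n, OF assms] by (cases "n = 0") simp_all
qed

lemma nds_entropy_partition_nonneg: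
  assumes "\<And>n. borel_partition (X n) (P n)"
  shows "0 \<le> nds_entropy_partition X f \<mu> P"
  unfolding nds_entropy_partition_eq[OF assms]
  by (rule le_Limsup) (simp_all add: block_entropy_nonneg)

end

section \<open>Compact cores and the correction function\<close>

lemma admissible_borel_partition: "P \<in> admissible X \<mu> \<Longrightarrow> borel_partition (X n) (P n)"
  by (simp add: admissible_def)

lemma admissible_compact_cores:
  assumes P: "P \<in> admissible X \<mu>" and e: "\<epsilon> > 0"
  obtains \<delta> K where "\<delta> > 0"
    "\<And>n A. A \<in> P n \<Longrightarrow> compactin (mtopology_of (X n)) (K n A)"
    "\<And>n A. A \<in> P n \<Longrightarrow> K n A \<subseteq> A" "\<And>n A. A \<in> P n \<Longrightarrow> measure (\<mu> n) (A - K n A) \<le> \<epsilon>"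
    "\<And>n A B x y. \<lbrakk>A \<in> P n; B \<in> P n; A \<noteq> B; x \<in> K n A; y \<in> K n B\<rbrakk> \<Longrightarrow> mdist (X n) x y \<ge> \<delta>"
proof -
  have "\<exists>\<delta>>0. \<exists>K.
        (\<forall>n. \<forall>A\<in>P n. compactin (mtopology_of (X n)) (K n A) \<and> K n A \<subseteq> A \<and>
           measure (\<mu> n) (A - K n A) \<le> \<epsilon>) \<and>
        (\<forall>n. \<forall>A\<in>P n. \<forall>B\<in>P n. A \<noteq> B \<longrightarrow>
           (\<forall>x\<in>K n A. \<forall>y\<in>K n B. mdist (X n) x y \<ge> \<delta>))"
    using P e by (simp add: admissible_def)
  then obtain \<delta> K where "\<delta> > 0"
    and K: "\<forall>n. \<forall>A\<in>P n. compactin (mtopology_of (X n)) (K n A) \<and> K n A \<subseteq> A \<and> measure (\<mu> n) (A - K n A) \<le> \<epsilon>"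
    and far: "\<forall>n. \<forall>A\<in>P n. \<forall>B\<in>P n. A \<noteq> B \<longrightarrow> (\<forall>x\<in>K n A. \<forall>y\<in>K n B. mdist (X n) x y \<ge> \<delta>)"
    by (elim exE conjE)
  show ?thesis
    by (rule that[OF \<open>\<delta> > 0\<close>, of K]) (simp_all add: K far)
qed

text \<open>Off a small set the \<open>Q\<close>-cell is determined by the \<open>P\<close>-cell; recording the \<open>Q\<close>-cell
  on that small set only gives a function \<open>r\<close> of small entropy that makes up for the difference.\<close>

lemma (in prob_space) correction_entropy:
  assumes Q: "finite Q" "partition_on (space M) Q" "Q \<subseteq> sets M" "card Q \<le> k"
    and P: "finite P" "partition_on (space M) P" "P \<subseteq> sets M"
    and K: "\<And>A. A \<in> Q \<Longrightarrow> K A \<subseteq> A" "\<And>A. A \<in> Q \<Longrightarrow> K A \<in> sets M" "\<And>A. A \<in> Q \<Longrightarrow> prob (A - K A) \<le> \<eta>"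
    and sep: "\<And>C A B. \<lbrakk>C \<in> P; A \<in> Q; B \<in> Q; A \<noteq> B\<rbrakk> \<Longrightarrow> C \<inter> K A = {} \<or> C \<inter> K B = {}"
    and d: "\<And>t. \<lbrakk>0 \<le> t; t \<le> 1; t \<le> d \<or> 1 - d \<le> t\<rbrakk> \<Longrightarrow> - (t * ln t) \<le> e"
    and \<eta>: "0 \<le> \<eta>" "\<eta> \<le> d" "real k * \<eta> \<le> d" and e: "0 \<le> e"
  obtains r :: "'a \<Rightarrow> 'a set set option" where "simple_function M r" "fun_entropy M r \<le> (real k + 1) * e"
    "\<And>x y. cells P x = cells P y \<Longrightarrow> r x = r y \<Longrightarrow> cells Q x = cells Q y"
proof -
  \<comment> \<open>\<open>h\<close> guesses the \<open>Q\<close>-cell from the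
    \<open>P\<close>-cell, as the cell whose core is met. \<open>r\<close> is \<open>None\<close>
    where the guess is right and reports the true cell elsewhere, so guess and \<open>r\<close>
    together recover the cell.\<close>
  define h where "h c = {A \<in> Q. \<exists>C\<in>c. C \<inter> K A \<noteq> {}}" for c
  define r where "r x = (if cells Q x = h (cells P x) then None else Some (cells Q x))" for x
  have good: "r x = None" if A: "A \<in> Q" "x \<in> K A" for A x
  proof -
    have xA: "x \<in> A" using K(1) A by blast
    then have "x \<in> space M" using Q(3) A(1) sets.sets_into_space by blast
    then obtain C where C: "C \<in> P" "x \<in> C" using P(2) by (auto simp: partition_on_def)
    have "B = A" if "B \<in> Q" "C \<inter> K B \<noteq> {}" for B
      using sep[OF C(1) that(1) A(1)] that(2) C(2) A(2) by blast
    \<comment> \<open>\<open>C\<close> meets the core of \<open>A\<close> at \<open>x\<close> and by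
      \<open>sep\<close> no other core, so the guess is right on every core.\<close>
    then have "h {C} = {A}" using A C unfolding h_def by blast
    then show ?thesis by (simp add: r_def cells_eq[OF Q(2) A(1) xA] cells_eq[OF P(2) C])
  qed
  have simp: "simple_function M r"
    using simple_function_compose2[OF simple_function_cells[OF Q(1,3)] simple_function_cells[OF P(1,3)],
        of "\<lambda>c d. if c = h d then None else Some c"]
    by (simp add: r_def[abs_def])
  have img: "r ` space M \<subseteq> insert None ((\<lambda>A. Some {A}) ` Q)"
  proof
    fix c assume "c \<in> r ` space M"
    then obtain x where x: "x \<in> space M" "c = r x" by blast
    then obtain A where "A \<in> Q" "x \<in> A" using Q(2) by (auto simp: partition_on_def)
    then show "c \<in> insert None ((\<lambda>A. Some {A}) ` Q)"
      using x(2) cells_eq[OF Q(2)] by (auto simp: r_def)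
  qed
  have bad: "A - K A \<in> sets M" if "A \<in> Q" for A using that Q(3) K(2) by auto
  \<comment> \<open>\<open>None\<close> fails only on the at most \<open>k\<close> sets
    \<open>A - K A\<close>, so its probability is near 1; a value \<open>Some {A}\<close> occurs
    only inside one such set, so its probability is near 0.\<close>
  have small: "prob (r -` {c} \<inter> space M) \<le> d \<or> 1 - d \<le> prob (r -` {c} \<inter> space M)"
    if c: "c \<in> r ` space M" for c
  proof (cases "c = None")
    case True
    have "prob (space M - r -` {None} \<inter> space M) \<le> prob (\<Union>A\<in>Q. A - K A)"
    proof (rule finite_measure_mono)
      show "space M - r -` {None} \<inter> space M \<subseteq> (\<Union>A\<in>Q. A - K A)"
      proof
        fix x assume x: "x \<in> space M - r -` {None} \<inter> space M"
        then obtain A where A: "A \<in> Q" "x \<in> A" using Q(2) by (auto simp: partition_on_def)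
        have "r x \<noteq> None" using x by auto
        then have "x \<notin> K A" using good[OF A(1)] by (rule contrapos_nn)
        then show "x \<in> (\<Union>A\<in>Q. A - K A)" using A by (intro UN_I[of A]) simp_all
      qed
      show "(\<Union>A\<in>Q. A - K A) \<in> sets M" using Q(1) bad by (rule sets.finite_UN)
    qed
    also have "\<dots> \<le> (\<Sum>A\<in>Q. prob (A - K A))"
      by (rule finite_measure_subadditive_finite[OF Q(1)]) (use bad in blast)
    also have "\<dots> \<le> (\<Sum>A\<in>Q. \<eta>)" by (rule sum_mono) (rule K(3))
    also have "\<dots> \<le> real k * \<eta>" using Q(4) \<eta>(1) by (simp add: mult_right_mono)
    finally have "1 - prob (r -` {None} \<inter> space M) \<le> d"
      using prob_compl[OF simple_functionD(2)[OF simp, of "{None}"]] \<eta>(3) by simp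
    then show ?thesis using True by simp
  next
    case False
    then obtain A where A: "A \<in> Q" "c = Some {A}" using c img by auto
    have "r -` {c} \<inter> space M \<subseteq> A - K A"
    proof
      fix x assume x: "x \<in> r -` {c} \<inter> space M"
      then have "cells Q x = {A}" using A by (auto simp: r_def split: if_splits)
      then have "x \<in> A" by (auto simp: cells_def)
      then show "x \<in> A - K A" using good[OF A(1), of x] x A(2) by auto
    qed
    then have "prob (r -` {c} \<inter> space M) \<le> prob (A - K A)"
      by (rule finite_measure_mono[OF _ bad[OF A(1)]])
    then show ?thesis using K(3)[OF A(1)] \<eta>(2) by linarith
  qed
  have "fun_entropy M r = (\<Sum>c\<in>r ` space M. - (prob (r -` {c} \<inter> space M) * ln (prob (r -` {c} \<inter> space M))))"
    by (simp add: fun_entropy_def sum_negf)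
  also have "\<dots> \<le> (\<Sum>c\<in>r ` space M. e)"
    by (intro sum_mono d small) auto
  also have "\<dots> = real (card (r ` space M)) * e" by simp
  \<comment> \<open>The value \<open>None\<close> and at most one value per cell of
    \<open>Q\<close>.\<close>
  also have "\<dots> \<le> (real k + 1) * e"
  proof (rule mult_right_mono[OF _ e])
    have "card (r ` space M) \<le> card (insert None ((\<lambda>A. Some {A}) ` Q))"
      by (rule card_mono[OF _ img]) (use Q(1) in auto)
    also have "\<dots> \<le> Suc (card ((\<lambda>A. Some {A}) ` Q))" by (rule card_insert_le_m1) auto
    also have "\<dots> \<le> Suc k" using card_image_le[OF Q(1), of "\<lambda>A. Some {A}"] Q(4) by linarith
    finally show "real (card (r ` space M)) \<le> real k + 1" by linarith
  qed
  finally have "fun_entropy M r \<le> (real k + 1) * e" .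
  moreover have "cells Q x = cells Q y" if "cells P x = cells P y" "r x = r y" for x y
    using that by (auto simp: r_def split: if_splits)
  ultimately show ?thesis using that simp by blast
qed

context nds_ims
begin

text \<open>\<delta> is the separation of the compact cores of \<open>Q\<close>, uniform in time. It
  is fixed before \<open>P\<close> is known, hence the quantification over \<open>P\<close> in the
  conclusion: fine sequences are picked afterwards.\<close>

lemma nds_entropy_partition_le_fine:
  assumes Q: "Q \<in> admissible X \<mu>" and e: "e > 0"
  obtains \<delta> where "\<delta> > 0"
    "\<And>P. \<lbrakk>\<And>n. borel_partition (X n) (P n);
        \<And>n A x y. \<lbrakk>A \<in> P n; x \<in> A; y \<in> A\<rbrakk> \<Longrightarrow> mdist (X n) x y < \<delta>\<rbrakk>
      \<Longrightarrow> nds_entropy_partition X f \<mu> Q \<le> nds_entropy_partition X f \<mu> P + ereal e"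
proof -
  obtain k where k: "\<And>n. card (Q n) \<le> k" using Q by (auto simp: admissible_def)
  \<comment> \<open>The correction takes at most \<open>k + 1\<close> values, each contributing at
    most \<open>e'\<close> to its entropy.\<close>
  define e' where "e' = e / (real k + 1)"
  have e': "e' > 0" using e by (simp add: e'_def)
  obtain d where d: "d > 0" "\<And>t. \<lbrakk>0 \<le> t; t \<le> 1; t \<le> d \<or> 1 - d \<le> t\<rbrakk> \<Longrightarrow> - (t * ln t) \<le> e'"
    using uminus_mult_ln_small[OF e'] by metis
  \<comment> \<open>Small enough both for one bad set and for \<open>k\<close> of them together; the
    \<open>+ 1\<close> avoids a division by zero.\<close>
  define \<eta> where "\<eta> = d / (real k + 1)"
  have \<eta>: "\<eta> > 0" "\<eta> \<le> d" "real k * \<eta> \<le> d"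
    using d(1) by (auto simp: \<eta>_def field_simps)
  obtain \<delta> K where \<delta>: "\<delta> > 0"
    and K: "\<And>n A. A \<in> Q n \<Longrightarrow> compactin (mtopology_of (X n)) (K n A)"
      "\<And>n A. A \<in> Q n \<Longrightarrow> K n A \<subseteq> A" "\<And>n A. A \<in> Q n \<Longrightarrow> measure (\<mu> n) (A - K n A) \<le> \<eta>"
    and far: "\<And>n A B x y. \<lbrakk>A \<in> Q n; B \<in> Q n; A \<noteq> B; x \<in> K n A; y \<in> K n B\<rbrakk> \<Longrightarrow> mdist (X n) x y \<ge> \<delta>"
    by (rule admissible_compact_cores[OF Q \<eta>(1)], rule that)
  have Qb: "borel_partition (X n) (Q n)" for n by (rule admissible_borel_partition[OF Q])
  have Kb: "K n A \<in> sets (\<mu> n)" if "A \<in> Q n" for n A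
    using compactin_in_mborel[OF K(1)[OF that]] by (simp add: sets_ims)
  show ?thesis
  proof (rule that[OF \<delta>])
    fix P assume Pb: "\<And>n. borel_partition (X n) (P n)"
      and fine: "\<And>n A x y. \<lbrakk>A \<in> P n; x \<in> A; y \<in> A\<rbrakk> \<Longrightarrow> mdist (X n) x y < \<delta>"
    have "\<exists>r :: 'a \<Rightarrow> 'a set set option. simple_function (\<mu> i) r \<and> fun_entropy (\<mu> i) r \<le> e \<and>
        (\<forall>x y. cells (P i) x = cells (P i) y \<longrightarrow> r x = r y \<longrightarrow> cells (Q i) x = cells (Q i) y)" for i
    proof (rule prob_space.correction_entropy[OF prob_space_ims, of "Q i" i k "P i" "K i" \<eta> d e'])
      show "finite (Q i)" "partition_on (space (\<mu> i)) (Q i)" "Q i \<subseteq> sets (\<mu> i)"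
        using Qb[of i] by (simp_all add: borel_partition_def space_ims sets_ims)
      show "finite (P i)" "partition_on (space (\<mu> i)) (P i)" "P i \<subseteq> sets (\<mu> i)"
        using Pb[of i] by (simp_all add: borel_partition_def space_ims sets_ims)
      \<comment> \<open>Points of a \<open>P\<close>-cell are closer than \<delta>, points of
        distinct cores are not, so a cell meets at most one core.\<close>
      show "C \<inter> K i A = {} \<or> C \<inter> K i B = {}" if "C \<in> P i" "A \<in> Q i" "B \<in> Q i" "A \<noteq> B" for C A B
      proof (rule ccontr)
        assume "\<not> ?thesis"
        then obtain x y where "x \<in> C" "x \<in> K i A" "y \<in> C" "y \<in> K i B" by auto
        then show False using fine[OF that(1), of x y] far[OF that(2,3,4), of x y] by auto
      qed
      fix r :: "'a \<Rightarrow> 'a set set option"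
      assume r: "simple_function (\<mu> i) r" "fun_entropy (\<mu> i) r \<le> (real k + 1) * e'"
        "\<And>x y. cells (P i) x = cells (P i) y \<Longrightarrow> r x = r y \<Longrightarrow> cells (Q i) x = cells (Q i) y"
      have "fun_entropy (\<mu> i) r \<le> e" using r(2) by (simp add: e'_def)
      then show ?thesis
        by (intro exI[of _ r] conjI allI impI) (rule r(1), assumption, rule r(3))
    qed (fact k K Kb d(2) \<eta> less_imp_le[OF e'] less_imp_le[OF \<eta>(1)])+
    then obtain r :: "nat \<Rightarrow> 'a \<Rightarrow> 'a set set option" where r: "\<And>i. simple_function (\<mu> i) (r i)"
        "\<And>i. fun_entropy (\<mu> i) (r i) \<le> e"
        "\<And>i x y. cells (P i) x = cells (P i) y \<Longrightarrow> r i x = r i y \<Longrightarrow> cells (Q i) x = cells (Q i) y"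
      by metis
    have b: "block_entropy f \<mu> Q n \<le> block_entropy f \<mu> P n + real n * e" for n
    proof -
      have "block_entropy f \<mu> Q n \<le> block_entropy f \<mu> P n + (\<Sum>i<n. fun_entropy (\<mu> i) (r i))"
        unfolding block_entropy_def
        by (rule prob_space.fun_entropy_itinerary_le[OF prob_space_ims simple_function_cells_ims[OF Pb] r(1)
              measurable_nds_iter distr_nds_iter r(3)])
      also have "(\<Sum>i<n. fun_entropy (\<mu> i) (r i)) \<le> (\<Sum>i<n. e)" by (intro sum_mono r)
      finally show ?thesis by simp
    qed
    \<comment> \<open>The \<open>n\<close> errors of size \<open>e\<close> average to
      \<open>e\<close>; at \<open>n = 0\<close> both averages are 0.\<close>
    have "1 / real n * block_entropy f \<mu> Q n \<le> 1 / real n * block_entropy f \<mu> P n + e" for n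
    proof (cases "n = 0")
      case False
      then have "1 / real n * block_entropy f \<mu> Q n \<le> 1 / real n * (block_entropy f \<mu> P n + real n * e)"
        by (intro mult_left_mono b) auto
      also have "\<dots> = 1 / real n * block_entropy f \<mu> P n + e" using False by (simp add: distrib_left)
      finally show ?thesis .
    qed (use e in simp)
    then have "limsup (\<lambda>n. ereal (1 / real n * block_entropy f \<mu> Q n))
        \<le> limsup (\<lambda>n. ereal (1 / real n * block_entropy f \<mu> P n) + ereal e)"
      by (intro Limsup_mono always_eventually allI) simp
    also have "\<dots> \<le> limsup (\<lambda>n. ereal (1 / real n * block_entropy f \<mu> P n)) + limsup (\<lambda>n. ereal e)"
      by (rule ereal_limsup_add_mono)
    also have "limsup (\<lambda>n. ereal e) = ereal e" by (simp add: Limsup_const)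
    finally show "nds_entropy_partition X f \<mu> Q \<le> nds_entropy_partition X f \<mu> P + ereal e"
      by (simp add: nds_entropy_partition_eq[OF Qb] nds_entropy_partition_eq[OF Pb])
  qed
qed

end

lemma fine_scale_ims_obtain:
  assumes "fine_scale_ims X f \<mu>" and "\<delta> > 0"
  obtains P where "P \<in> admissible X \<mu>"
    "\<And>n A x y. \<lbrakk>A \<in> P n; x \<in> A; y \<in> A\<rbrakk> \<Longrightarrow> mdist (X n) x y < \<delta>"
proof -
  obtain P where P: "\<And>k. P k \<in> admissible X \<mu>" "(\<lambda>k. seq_diam X (P k)) \<longlonglongrightarrow> 0"
    using assms(1) by (auto simp: fine_scale_ims_def)
  have "eventually (\<lambda>k. seq_diam X (P k) < ennreal \<delta>) sequentially"
    using order_tendstoD(2)[OF P(2), of "ennreal \<delta>"] assms(2) by simp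
  then obtain k where k: "seq_diam X (P k) < ennreal \<delta>" by (auto simp: eventually_sequentially)
  show ?thesis
  proof (rule that[OF P(1)[of k]])
    fix n A x y assume A: "A \<in> P k n" "x \<in> A" "y \<in> A"
    have "ennreal (mdist (X n) x y) \<le> (SUP y\<in>A. ennreal (mdist (X n) x y))"
      by (rule SUP_upper[OF A(3)])
    also have "\<dots> \<le> (SUP x\<in>A. SUP y\<in>A. ennreal (mdist (X n) x y))" by (rule SUP_upper[OF A(2)])
    also have "\<dots> \<le> (SUP A\<in>P k n. SUP x\<in>A. SUP y\<in>A. ennreal (mdist (X n) x y))"
      by (rule SUP_upper[OF A(1)])
    also have "\<dots> \<le> seq_diam X (P k)" unfolding seq_diam_def by (rule SUP_upper) simp
    also note k
    finally show "mdist (X n) x y < \<delta>" by (simp add: ennreal_less_iff)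
  qed
qed

section \<open>Products of systems\<close>

lemma nds_iter_prod_maps: "nds_iter (prod_maps f g) k n = map_prod (nds_iter f k n) (nds_iter g k n)"
  by (induction n) (auto simp: prod_maps_def fun_eq_iff)

lemma topological_nds_prod:
  assumes X: "topological_nds X f" and Y: "topological_nds Y g"
  shows "topological_nds (prod_spaces X Y) (prod_maps f g)"
  unfolding topological_nds_def
proof (intro conjI allI impI)
  fix n
  show "mspace (prod_spaces X Y n) \<noteq> {}"
    using X Y by (simp add: prod_spaces_def topological_nds_def)
  show "compact_space (mtopology_of (prod_spaces X Y n))"
    using X Y by (simp add: prod_spaces_def topological_nds_def mtopology_of_max_metric compact_space_prod_topology)
  have "f n \<in> mspace (X n) \<rightarrow> mspace (X (Suc n))" "g n \<in> mspace (Y n) \<rightarrow> mspace (Y (Suc n))"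
    using X Y by (simp_all add: topological_nds_def)
  then show "prod_maps f g n \<in> mspace (prod_spaces X Y n) \<rightarrow> mspace (prod_spaces X Y (Suc n))"
    by (auto simp: prod_maps_def prod_spaces_def)
next
  fix e :: real assume e: "e > 0"
  obtain d1 where d1: "d1 > 0" "\<forall>n. \<forall>x\<in>mspace (X n). \<forall>y\<in>mspace (X n).
        mdist (X n) x y < d1 \<longrightarrow> mdist (X (Suc n)) (f n x) (f n y) < e"
    using X e unfolding topological_nds_def by meson
  obtain d2 where d2: "d2 > 0" "\<forall>n. \<forall>x\<in>mspace (Y n). \<forall>y\<in>mspace (Y n).
        mdist (Y n) x y < d2 \<longrightarrow> mdist (Y (Suc n)) (g n x) (g n y) < e"
    using Y e unfolding topological_nds_def by meson
  show "\<exists>\<delta>>0. \<forall>n. \<forall>x\<in>mspace (prod_spaces X Y n). \<forall>y\<in>mspace (prod_spaces X Y n).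
      mdist (prod_spaces X Y n) x y < \<delta> \<longrightarrow>
      mdist (prod_spaces X Y (Suc n)) (prod_maps f g n x) (prod_maps f g n y) < e"
  proof (intro exI[of _ "min d1 d2"] conjI allI ballI impI)
    fix n x y assume "x \<in> mspace (prod_spaces X Y n)" "y \<in> mspace (prod_spaces X Y n)"
      "mdist (prod_spaces X Y n) x y < min d1 d2"
    then have "fst x \<in> mspace (X n)" "fst y \<in> mspace (X n)" "snd x \<in> mspace (Y n)" "snd y \<in> mspace (Y n)"
      "mdist (X n) (fst x) (fst y) < d1" "mdist (Y n) (snd x) (snd y) < d2"
      by (auto simp: prod_spaces_def)
    then show "mdist (prod_spaces X Y (Suc n)) (prod_maps f g n x) (prod_maps f g n y) < e"
      using d1(2) d2(2) by (simp add: prod_spaces_def prod_maps_def)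
  qed (use d1(1) d2(1) in simp)
qed

text \<open>Compactness identifies the product sigma-algebra with the Borel one, and the image of a
  product measure under a product map is the product of the images.\<close>

lemma nds_ims_prod:
  assumes "nds_ims X f \<mu>" and "nds_ims Y g \<nu>"
  shows "nds_ims (prod_spaces X Y) (prod_maps f g) (prod_measures \<mu> \<nu>)"
proof -
  interpret X: nds_ims X f \<mu> by fact
  interpret Y: nds_ims Y g \<nu> by fact
  show ?thesis
  proof
    show "topological_nds (prod_spaces X Y) (prod_maps f g)"
      by (rule topological_nds_prod[OF X.nds Y.nds])
    show "ims (prod_spaces X Y) (prod_maps f g) (prod_measures \<mu> \<nu>)"
      unfolding ims_def
    proof (intro conjI allI)
      fix n
      interpret Xn: prob_space "\<mu> n" by (rule X.prob_space_ims)
      interpret Yn: prob_space "\<nu> n" by (rule Y.prob_space_ims)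
      interpret XYn: pair_prob_space "\<mu> n" "\<nu> n" ..
      show "prob_space (prod_measures \<mu> \<nu> n)" by (simp add: prod_measures_def XYn.prob_space_axioms)
      show "space (prod_measures \<mu> \<nu> n) = mspace (prod_spaces X Y n)"
        by (simp add: prod_measures_def prod_spaces_def space_pair_measure X.space_ims Y.space_ims)
      show "sets (prod_measures \<mu> \<nu> n) = sets (mborel (prod_spaces X Y n))"
        unfolding prod_measures_def prod_spaces_def sets_mborel_max_metric[OF X.compact_nds Y.compact_nds]
        by (rule sets_pair_measure_cong[OF X.sets_ims Y.sets_ims])
      have "sigma_finite_measure (distr (\<nu> n) (\<nu> (Suc n)) (g n))"
        unfolding Y.distr_ims using Y.prob_space_ims[of "Suc n"]
        by (simp add: prob_space_imp_sigma_finite)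
      from pair_measure_distr[OF X.measurable_nds Y.measurable_nds this]
      show "distr (prod_measures \<mu> \<nu> n) (prod_measures \<mu> \<nu> (Suc n)) (prod_maps f g n)
          = prod_measures \<mu> \<nu> (Suc n)"
        by (simp add: prod_measures_def prod_maps_def map_prod_def X.distr_ims Y.distr_ims)
    qed
  qed
qed

definition prod_partition ::
    "(nat \<Rightarrow> 'a set set) \<Rightarrow> (nat \<Rightarrow> 'b set set) \<Rightarrow> nat \<Rightarrow> ('a \<times> 'b) set set" where
  "prod_partition P R n = (\<lambda>(A, B). A \<times> B) ` (P n \<times> R n)"

lemma prod_partition_iff: "D \<in> prod_partition P R n \<longleftrightarrow> (\<exists>A\<in>P n. \<exists>B\<in>R n. D = A \<times> B)"
  by (auto simp: prod_partition_def)

lemma borel_partition_prod: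
  assumes P: "borel_partition (X n) (P n)" and R: "borel_partition (Y n) (R n)"
    and c1: "compact_space (mtopology_of (X n))" and c2: "compact_space (mtopology_of (Y n))"
  shows "borel_partition (prod_spaces X Y n) (prod_partition P R n)"
  unfolding borel_partition_def
proof (intro conjI)
  have fin: "finite (P n)" "finite (R n)" and
    p: "partition_on (mspace (X n)) (P n)" "partition_on (mspace (Y n)) (R n)" and
    s: "P n \<subseteq> sets (mborel (X n))" "R n \<subseteq> sets (mborel (Y n))"
    using P R by (simp_all add: borel_partition_def)
  show "finite (prod_partition P R n)" using fin by (simp add: prod_partition_def)
  show "prod_partition P R n \<subseteq> sets (mborel (prod_spaces X Y n))"
  proof
    fix D assume "D \<in> prod_partition P R n"
    then obtain A B where "A \<in> P n" "B \<in> R n" "D = A \<times> B" unfolding prod_partition_iff by blast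
    then show "D \<in> sets (mborel (prod_spaces X Y n))"
      using s unfolding prod_spaces_def sets_mborel_max_metric[OF c1 c2] by auto
  qed
  show "partition_on (mspace (prod_spaces X Y n)) (prod_partition P R n)"
  proof (rule partition_onI)
    have "\<Union> (prod_partition P R n) = \<Union> (P n) \<times> \<Union> (R n)"
      by (auto simp: prod_partition_def)
    then show "\<Union> (prod_partition P R n) = mspace (prod_spaces X Y n)"
      using p by (simp add: partition_on_def prod_spaces_def)
  next
    fix D E assume "D \<in> prod_partition P R n" "E \<in> prod_partition P R n" "D \<noteq> E"
    then obtain A B A' B' where AB: "A \<in> P n" "B \<in> R n" "D = A \<times> B" "A' \<in> P n" "B' \<in> R n" "E = A' \<times> B'"
      unfolding prod_partition_iff by blast
    then have "A \<noteq> A' \<or> B \<noteq> B'" using \<open>D \<noteq> E\<close> by blast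
    then have "A \<inter> A' = {} \<or> B \<inter> B' = {}"
      using disjointD[OF partition_onD2[OF p(1)] AB(1,4)] disjointD[OF partition_onD2[OF p(2)] AB(2,5)] by blast
    then show "disjnt D E" using AB by (auto simp: disjnt_def)
  next
    show "{} \<notin> prod_partition P R n"
    proof
      assume "{} \<in> prod_partition P R n"
      then obtain A B where "A \<in> P n" "B \<in> R n" "A \<times> B = {}" unfolding prod_partition_iff by metis
      then have "{} \<in> P n \<or> {} \<in> R n" by (auto simp: Sigma_empty_iff)
      then show False using p by (simp add: partition_on_def)
    qed
  qed
qed

context
  fixes X :: "nat \<Rightarrow> 'a metric" and f :: "nat \<Rightarrow> 'a \<Rightarrow> 'a" and \<mu> :: "nat \<Rightarrow> 'a measure"
    and Y :: "nat \<Rightarrow> 'b metric" and g :: "nat \<Rightarrow> 'b \<Rightarrow> 'b" and \<nu> :: "nat \<Rightarrow> 'b measure"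
  assumes X: "nds_ims X f \<mu>" and Y: "nds_ims Y g \<nu>"
begin

interpretation X: nds_ims X f \<mu> by (rule X)
interpretation Y: nds_ims Y g \<nu> by (rule Y)
interpretation XY: nds_ims "prod_spaces X Y" "prod_maps f g" "prod_measures \<mu> \<nu>"
  by (rule nds_ims_prod[OF X Y])

text \<open>The rectangle visited at each time is the pair of cells visited by the two coordinates.
  Under a product measure the two itineraries are independent, so the entropies add at every time
  \<open>n\<close>, before any limsup.\<close>

lemma block_entropy_prod:
  assumes P: "\<And>n. borel_partition (X n) (P n)" and R: "\<And>n. borel_partition (Y n) (R n)"
  shows "block_entropy (prod_maps f g) (prod_measures \<mu> \<nu>) (prod_partition P R) n
    = block_entropy f \<mu> P n + block_entropy g \<nu> R n"
proof -
  let ?p = "itinerary (nds_iter f 0) (\<lambda>i. cells (P i)) n" and ?q = "itinerary (nds_iter g 0) (\<lambda>i. cells (R i)) n"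
  let ?pq = "itinerary (nds_iter (prod_maps f g) 0) (\<lambda>i. cells (prod_partition P R i)) n"
  let ?M = "prod_measures \<mu> \<nu> 0"
  have PR: "borel_partition (prod_spaces X Y n) (prod_partition P R n)" for n
    by (rule borel_partition_prod[OF P R X.compact_nds Y.compact_nds])
  have sp: "simple_function (\<mu> 0) ?p" by (rule X.simple_function_itinerary_cells[OF P])
  have sq: "simple_function (\<nu> 0) ?q" by (rule Y.simple_function_itinerary_cells[OF R])
  have spq: "simple_function ?M ?pq" by (rule XY.simple_function_itinerary_cells[OF PR])
  have fst: "fst \<in> measurable ?M (\<mu> 0)" and snd: "snd \<in> measurable ?M (\<nu> 0)"
    by (simp_all add: prod_measures_def)
  \<comment> \<open>The values, lists of sets of rectangles and pairs of lists, have different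
    types; only level sets are compared.\<close>
  have "fun_entropy ?M ?pq = fun_entropy ?M (\<lambda>z. (?p (fst z), ?q (snd z)))"
  proof (rule prob_space.fun_entropy_cong_kernel[OF XY.prob_space_ims spq])
    show "simple_function ?M (\<lambda>z. (?p (fst z), ?q (snd z)))"
      by (rule simple_function_Pair[OF simple_function_comp[OF fst sp] simple_function_comp[OF snd sq]])
    fix z w assume z: "z \<in> space ?M" and w: "w \<in> space ?M"
    have "cells (prod_partition P R i) (nds_iter (prod_maps f g) 0 i z) = cells (prod_partition P R i) (nds_iter (prod_maps f g) 0 i w)
      \<longleftrightarrow> cells (P i) (nds_iter f 0 i (fst z)) = cells (P i) (nds_iter f 0 i (fst w))
        \<and> cells (R i) (nds_iter g 0 i (snd z)) = cells (R i) (nds_iter g 0 i (snd w))" for i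
    proof -
      let ?x = "nds_iter f 0 i (fst z)" and ?x' = "nds_iter f 0 i (fst w)"
      let ?y = "nds_iter g 0 i (snd z)" and ?y' = "nds_iter g 0 i (snd w)"
      have m: "?x \<in> mspace (X i)" "?y \<in> mspace (Y i)"
        using z measurable_space[OF X.measurable_nds_iter, of "fst z"] measurable_space[OF Y.measurable_nds_iter, of "snd z"]
        by (auto simp: prod_measures_def space_pair_measure X.space_ims Y.space_ims)
      have po: "partition_on (mspace (X i)) (P i)" "partition_on (mspace (Y i)) (R i)"
        "partition_on (mspace (X i) \<times> mspace (Y i)) (prod_partition P R i)"
        using P R PR[of i] by (simp_all add: borel_partition_def prod_spaces_def)
      have it: "nds_iter (prod_maps f g) 0 i z = (?x, ?y)" "nds_iter (prod_maps f g) 0 i w = (?x', ?y')"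
        by (simp_all add: nds_iter_prod_maps map_prod_def split_beta)
      have "(\<exists>D\<in>prod_partition P R i. (?x, ?y) \<in> D \<and> (?x', ?y') \<in> D)
        \<longleftrightarrow> (\<exists>A\<in>P i. ?x \<in> A \<and> ?x' \<in> A) \<and> (\<exists>B\<in>R i. ?y \<in> B \<and> ?y' \<in> B)"
      proof
        assume "\<exists>D\<in>prod_partition P R i. (?x, ?y) \<in> D \<and> (?x', ?y') \<in> D"
        then obtain D where D: "D \<in> prod_partition P R i" "(?x, ?y) \<in> D" "(?x', ?y') \<in> D"
          by (elim bexE conjE)
        from D(1) obtain A B where "A \<in> P i" "B \<in> R i" "D = A \<times> B" unfolding prod_partition_iff by blast
        with D(2,3) show "(\<exists>A\<in>P i. ?x \<in> A \<and> ?x' \<in> A) \<and> (\<exists>B\<in>R i. ?y \<in> B \<and> ?y' \<in> B)"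
          by blast
      next
        assume "(\<exists>A\<in>P i. ?x \<in> A \<and> ?x' \<in> A) \<and> (\<exists>B\<in>R i. ?y \<in> B \<and> ?y' \<in> B)"
        then obtain A B where AB: "A \<in> P i" "?x \<in> A" "?x' \<in> A" "B \<in> R i" "?y \<in> B" "?y' \<in> B"
          by (elim conjE bexE)
        then have "A \<times> B \<in> prod_partition P R i" unfolding prod_partition_iff by blast
        then show "\<exists>D\<in>prod_partition P R i. (?x, ?y) \<in> D \<and> (?x', ?y') \<in> D"
          by (rule bexI[rotated]) (simp add: AB)
      qed
      moreover have "(?x, ?y) \<in> mspace (X i) \<times> mspace (Y i)" using m by simp
      ultimately show ?thesis
        unfolding it by (simp only: cells_eq_iff[OF po(1) m(1)] cells_eq_iff[OF po(2) m(2)] cells_eq_iff[OF po(3)])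
    qed
    then show "(?p (fst z), ?q (snd z)) = (?p (fst w), ?q (snd w)) \<longleftrightarrow> ?pq z = ?pq w"
      unfolding prod.inject itinerary_eq_iff by blast
  qed
  also have "\<dots> = fun_entropy (\<mu> 0) ?p + fun_entropy (\<nu> 0) ?q"
    unfolding prod_measures_def
    by (rule fun_entropy_pair_measure[OF X.prob_space_ims Y.prob_space_ims sp sq])
  finally show ?thesis by (simp add: block_entropy_def)
qed

lemma admissible_prod:
  assumes P: "P \<in> admissible X \<mu>" and R: "R \<in> admissible Y \<nu>"
  shows "prod_partition P R \<in> admissible (prod_spaces X Y) (prod_measures \<mu> \<nu>)"
  unfolding admissible_def mem_Collect_eq
proof (intro conjI allI impI)
  note Pb = admissible_borel_partition[OF P] and Rb = admissible_borel_partition[OF R]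
  show "borel_partition (prod_spaces X Y n) (prod_partition P R n)" for n
    by (rule borel_partition_prod[OF Pb Rb X.compact_nds Y.compact_nds])
  obtain k l where kl: "\<And>n. card (P n) \<le> k" "\<And>n. card (R n) \<le> l"
    using P R by (auto simp: admissible_def)
  have "card (prod_partition P R n) \<le> k * l" for n
  proof -
    have "card (prod_partition P R n) \<le> card (P n \<times> R n)"
      unfolding prod_partition_def
      by (rule card_image_le) (use Pb[of n] Rb[of n] in \<open>simp add: borel_partition_def\<close>)
    also have "\<dots> \<le> k * l" using kl by (simp add: card_cartesian_product mult_le_mono)
    finally show ?thesis .
  qed
  then show "\<exists>k. \<forall>n. card (prod_partition P R n) \<le> k" by blast
next
  note Pb = admissible_borel_partition[OF P] and Rb = admissible_borel_partition[OF R]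
  fix e :: real assume "e > 0"
  then have e2: "e / 2 > 0" by simp
  obtain d1 K where d1: "d1 > 0"
    and K: "\<And>n A. A \<in> P n \<Longrightarrow> compactin (mtopology_of (X n)) (K n A)"
      "\<And>n A. A \<in> P n \<Longrightarrow> K n A \<subseteq> A" "\<And>n A. A \<in> P n \<Longrightarrow> measure (\<mu> n) (A - K n A) \<le> e / 2"
      "\<And>n A B x y. \<lbrakk>A \<in> P n; B \<in> P n; A \<noteq> B; x \<in> K n A; y \<in> K n B\<rbrakk> \<Longrightarrow> mdist (X n) x y \<ge> d1"
    by (rule admissible_compact_cores[OF P e2], rule that)
  obtain d2 L where d2: "d2 > 0"
    and L: "\<And>n A. A \<in> R n \<Longrightarrow> compactin (mtopology_of (Y n)) (L n A)"
      "\<And>n A. A \<in> R n \<Longrightarrow> L n A \<subseteq> A" "\<And>n A. A \<in> R n \<Longrightarrow> measure (\<nu> n) (A - L n A) \<le> e / 2"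
      "\<And>n A B x y. \<lbrakk>A \<in> R n; B \<in> R n; A \<noteq> B; x \<in> L n A; y \<in> L n B\<rbrakk> \<Longrightarrow> mdist (Y n) x y \<ge> d2"
    by (rule admissible_compact_cores[OF R e2], rule that)
  \<comment> \<open>Cores are indexed by the cell, so the two sides of the rectangle are read off by
    projection; this recovers them because cells are nonempty.\<close>
  define C where "C n D = K n (fst ` D) \<times> L n (snd ` D)" for n D
  have C: "C n (A \<times> B) = K n A \<times> L n B" if "A \<in> P n" "B \<in> R n" for n A B
  proof -
    have "A \<noteq> {}" "B \<noteq> {}" using that Pb[of n] Rb[of n] by (auto simp: borel_partition_def partition_on_def)
    then show ?thesis by (simp add: C_def)
  qed
  have meas: "measure (prod_measures \<mu> \<nu> n) (A \<times> B - K n A \<times> L n B) \<le> e"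
    if A: "A \<in> P n" and B: "B \<in> R n" for n A B
  proof -
    interpret Xn: prob_space "\<mu> n" by (rule X.prob_space_ims)
    interpret Yn: prob_space "\<nu> n" by (rule Y.prob_space_ims)
    interpret XYn: pair_prob_space "\<mu> n" "\<nu> n" ..
    have ms: "A \<in> sets (\<mu> n)" "B \<in> sets (\<nu> n)" "K n A \<in> sets (\<mu> n)" "L n B \<in> sets (\<nu> n)"
      using A B Pb[of n] Rb[of n] compactin_in_mborel[OF K(1)[OF A]] compactin_in_mborel[OF L(1)[OF B]]
      by (auto simp: borel_partition_def X.sets_ims Y.sets_ims)
    \<comment> \<open>The part of the rectangle outside the product core lies in two strips, each of
      measure at most \<open>e / 2\<close>.\<close>
    have "measure (\<mu> n \<Otimes>\<^sub>M \<nu> n) (A \<times> B - K n A \<times> L n B)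
        \<le> measure (\<mu> n \<Otimes>\<^sub>M \<nu> n) ((A - K n A) \<times> space (\<nu> n) \<union> space (\<mu> n) \<times> (B - L n B))"
      by (rule XYn.finite_measure_mono)
         (use ms sets.sets_into_space[OF ms(1)] sets.sets_into_space[OF ms(2)] in auto)
    also have "\<dots> \<le> measure (\<mu> n \<Otimes>\<^sub>M \<nu> n) ((A - K n A) \<times> space (\<nu> n)) + measure (\<mu> n \<Otimes>\<^sub>M \<nu> n) (space (\<mu> n) \<times> (B - L n B))"
      by (rule measure_Un_le) (use ms in auto)
    also have "measure (\<mu> n \<Otimes>\<^sub>M \<nu> n) ((A - K n A) \<times> space (\<nu> n)) = measure (\<mu> n) (A - K n A)"
      using ms by (simp add: measure_def Yn.emeasure_pair_measure_Times Yn.emeasure_space_1 sets.Diff)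
    also have "measure (\<mu> n \<Otimes>\<^sub>M \<nu> n) (space (\<mu> n) \<times> (B - L n B)) = measure (\<nu> n) (B - L n B)"
      using ms by (simp add: measure_def Yn.emeasure_pair_measure_Times Xn.emeasure_space_1 sets.Diff)
    finally show ?thesis using K(3)[OF A] L(3)[OF B] by (simp add: prod_measures_def)
  qed
  show "\<exists>\<delta>>0. \<exists>K. (\<forall>n. \<forall>A\<in>prod_partition P R n. compactin (mtopology_of (prod_spaces X Y n)) (K n A) \<and> K n A \<subseteq> A \<and>
           measure (prod_measures \<mu> \<nu> n) (A - K n A) \<le> e) \<and>
        (\<forall>n. \<forall>A\<in>prod_partition P R n. \<forall>B\<in>prod_partition P R n. A \<noteq> B \<longrightarrow>
           (\<forall>x\<in>K n A. \<forall>y\<in>K n B. mdist (prod_spaces X Y n) x y \<ge> \<delta>))"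
  proof (rule exI[of _ "min d1 d2"], rule conjI, simp add: d1 d2, rule exI[of _ C], intro conjI allI ballI impI)
    fix n D assume "D \<in> prod_partition P R n"
    then obtain A B where D: "A \<in> P n" "B \<in> R n" "D = A \<times> B" unfolding prod_partition_iff by blast
    note CD = C[OF D(1,2), folded D(3)]
    show "compactin (mtopology_of (prod_spaces X Y n)) (C n D)"
      unfolding CD prod_spaces_def mtopology_of_max_metric compactin_Times using K(1)[OF D(1)] L(1)[OF D(2)] by simp
    show "C n D \<subseteq> D" unfolding CD unfolding D(3) by (rule Sigma_mono) (use K(2)[OF D(1)] L(2)[OF D(2)] in auto)
    show "measure (prod_measures \<mu> \<nu> n) (D - C n D) \<le> e" unfolding CD unfolding D(3) by (rule meas[OF D(1,2)])
  next
    fix n D E x y assume DE: "D \<in> prod_partition P R n" "E \<in> prod_partition P R n" "D \<noteq> E" "x \<in> C n D" "y \<in> C n E"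
    from DE(1) obtain A B where D: "A \<in> P n" "B \<in> R n" "D = A \<times> B" unfolding prod_partition_iff by blast
    from DE(2) obtain A' B' where E: "A' \<in> P n" "B' \<in> R n" "E = A' \<times> B'" unfolding prod_partition_iff by blast
    have xy: "fst x \<in> K n A" "snd x \<in> L n B" "fst y \<in> K n A'" "snd y \<in> L n B'"
      using DE(4,5) C[OF D(1,2)] C[OF E(1,2)] D(3) E(3) by auto
    \<comment> \<open>Distinct rectangles differ in one factor, and the separation of the cores
      there bounds the max metric from below.\<close>
    have "A \<noteq> A' \<or> B \<noteq> B'" using DE(3) D(3) E(3) by blast
    then have "d1 \<le> mdist (X n) (fst x) (fst y) \<or> d2 \<le> mdist (Y n) (snd x) (snd y)"
      using K(4)[OF D(1) E(1) _ xy(1,3)] L(4)[OF D(2) E(2) _ xy(2,4)] by blast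
    then show "mdist (prod_spaces X Y n) x y \<ge> min d1 d2" by (auto simp: prod_spaces_def)
  qed
qed

text \<open>The left side stays a limsup of sums because it may be smaller than the sum of the
  limsups; each case of the theorem splits it by its own argument.\<close>

lemma nds_entropy_prod_ge:
  assumes "P \<in> admissible X \<mu>" and "R \<in> admissible Y \<nu>"
  shows "limsup (\<lambda>n. ereal (1 / real n * block_entropy f \<mu> P n) + ereal (1 / real n * block_entropy g \<nu> R n))
    \<le> nds_entropy (prod_spaces X Y) (prod_maps f g) (prod_measures \<mu> \<nu>)"
proof -
  note b = admissible_borel_partition[OF assms(1)] admissible_borel_partition[OF assms(2)]
    admissible_borel_partition[OF admissible_prod[OF assms]]
  have "limsup (\<lambda>n. ereal (1 / real n * block_entropy f \<mu> P n) + ereal (1 / real n * block_entropy g \<nu> R n))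
    = nds_entropy_partition (prod_spaces X Y) (prod_maps f g) (prod_measures \<mu> \<nu>) (prod_partition P R)"
    unfolding XY.nds_entropy_partition_eq[OF b(3)] block_entropy_prod[OF b(1,2)] by (simp add: distrib_left)
  also have "\<dots> \<le> nds_entropy (prod_spaces X Y) (prod_maps f g) (prod_measures \<mu> \<nu>)"
    unfolding nds_entropy_def by (rule SUP_upper[OF admissible_prod[OF assms]])
  finally show ?thesis .
qed

lemma nds_entropy_prod_le:
  assumes "fine_scale_ims X f \<mu>" and "fine_scale_ims Y g \<nu>"
  shows "nds_entropy (prod_spaces X Y) (prod_maps f g) (prod_measures \<mu> \<nu>) \<le> nds_entropy X f \<mu> + nds_entropy Y g \<nu>"
  unfolding nds_entropy_def[of "prod_spaces X Y"]
proof (rule SUP_least)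
  fix Q assume Q: "Q \<in> admissible (prod_spaces X Y) (prod_measures \<mu> \<nu>)"
  show "nds_entropy_partition (prod_spaces X Y) (prod_maps f g) (prod_measures \<mu> \<nu>) Q \<le> nds_entropy X f \<mu> + nds_entropy Y g \<nu>"
  proof (rule ereal_le_epsilon2)
    fix e :: real assume e: "e > 0"
    show "nds_entropy_partition (prod_spaces X Y) (prod_maps f g) (prod_measures \<mu> \<nu>) Q
      \<le> nds_entropy X f \<mu> + nds_entropy Y g \<nu> + ereal e"
    proof (rule XY.nds_entropy_partition_le_fine[OF Q e])
      fix d :: real assume d: "d > 0"
        and le: "\<And>S. \<lbrakk>\<And>n. borel_partition (prod_spaces X Y n) (S n);
          \<And>n A x y. \<lbrakk>A \<in> S n; x \<in> A; y \<in> A\<rbrakk> \<Longrightarrow> mdist (prod_spaces X Y n) x y < d\<rbrakk>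
        \<Longrightarrow> nds_entropy_partition (prod_spaces X Y) (prod_maps f g) (prod_measures \<mu> \<nu>) Q
          \<le> nds_entropy_partition (prod_spaces X Y) (prod_maps f g) (prod_measures \<mu> \<nu>) S + ereal e"
      obtain P where P: "P \<in> admissible X \<mu>" "\<And>n A x y. \<lbrakk>A \<in> P n; x \<in> A; y \<in> A\<rbrakk> \<Longrightarrow> mdist (X n) x y < d"
        by (rule fine_scale_ims_obtain[OF assms(1) d], rule that)
      obtain R where R: "R \<in> admissible Y \<nu>" "\<And>n A x y. \<lbrakk>A \<in> R n; x \<in> A; y \<in> A\<rbrakk> \<Longrightarrow> mdist (Y n) x y < d"
        by (rule fine_scale_ims_obtain[OF assms(2) d], rule that)
      note b = admissible_borel_partition[OF P(1)] admissible_borel_partition[OF R(1)]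
        admissible_borel_partition[OF admissible_prod[OF P(1) R(1)]]
      have "nds_entropy_partition (prod_spaces X Y) (prod_maps f g) (prod_measures \<mu> \<nu>) Q
          \<le> nds_entropy_partition (prod_spaces X Y) (prod_maps f g) (prod_measures \<mu> \<nu>) (prod_partition P R) + ereal e"
      \<comment> \<open>In the max metric, points of a rectangle are closer than \<open>d\<close> as
        soon as this holds on both sides.\<close>
      proof (rule le[OF b(3)])
        fix n D x y assume "D \<in> prod_partition P R n" "x \<in> D" "y \<in> D"
        then obtain A B where "A \<in> P n" "B \<in> R n" "x \<in> A \<times> B" "y \<in> A \<times> B" unfolding prod_partition_iff by blast
        then show "mdist (prod_spaces X Y n) x y < d" using P(2) R(2) by (auto simp: prod_spaces_def)
    qed
    also have "nds_entropy_partition (prod_spaces X Y) (prod_maps f g) (prod_measures \<mu> \<nu>) (prod_partition P R)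
      = limsup (\<lambda>n. ereal (1 / real n * block_entropy f \<mu> P n) + ereal (1 / real n * block_entropy g \<nu> R n))"
      unfolding XY.nds_entropy_partition_eq[OF b(3)] block_entropy_prod[OF b(1,2)] by (simp add: distrib_left)
    also have "\<dots> \<le> nds_entropy_partition X f \<mu> P + nds_entropy_partition Y g \<nu> R"
      unfolding X.nds_entropy_partition_eq[OF b(1)] Y.nds_entropy_partition_eq[OF b(2)]
      by (rule ereal_limsup_add_mono)
    also have "\<dots> \<le> nds_entropy X f \<mu> + nds_entropy Y g \<nu>"
      unfolding nds_entropy_def by (intro add_mono SUP_upper P(1) R(1))
    finally show "nds_entropy_partition (prod_spaces X Y) (prod_maps f g) (prod_measures \<mu> \<nu>) Q
      \<le> nds_entropy X f \<mu> + nds_entropy Y g \<nu> + ereal e"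
      by (simp add: add_right_mono)
    qed
  qed
qed

end

section \<open>Autonomous systems and the Kolmogorov--Sinai entropy\<close>

text \<open>Fekete's lemma.\<close>
lemma subadditive_convergent:
  fixes a :: "nat \<Rightarrow> real"
  assumes nn: "\<And>n. 0 \<le> a n" and sub: "\<And>m n. a (m + n) \<le> a m + a n"
  shows "convergent (\<lambda>n. 1 / real n * a n)"
proof -
  define L where "L = (INF n\<in>{0<..}. a n / real n)"
  have bdd: "bdd_below ((\<lambda>n. a n / real n) ` {0<..})"
    by (rule bdd_belowI[of _ 0]) (auto simp: nn)
  have low: "L \<le> a n / real n" if "n > 0" for n
    unfolding L_def by (rule cINF_lower[OF bdd]) (use that in simp)
  \<comment> \<open>Subadditivity along division with remainder: \<open>q\<close> blocks of length
    \<open>m\<close> and a rest \<open>r\<close>.\<close>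
  have mult: "a (q * m + r) \<le> real q * a m + a r" for q m r
  proof (induction q)
    case (Suc q)
    have "a (Suc q * m + r) \<le> a m + a (q * m + r)" using sub[of m "q * m + r"] by (simp add: add.assoc)
    then show ?case using Suc by (simp add: algebra_simps)
  qed simp
  have "(\<lambda>n. 1 / real n * a n) \<longlonglongrightarrow> L"
  proof (rule LIMSEQ_I)
    fix e :: real assume e: "e > 0"
    have "\<exists>y\<in>(\<lambda>n. a n / real n) ` {0<..}. y < L + e / 2"
      unfolding L_def using e bdd by (subst cInf_less_iff[symmetric]) auto
    then obtain m where m: "m > 0" "a m / real m < L + e / 2" by auto
    \<comment> \<open>A bound for \<open>a\<close> at all remainders modulo \<open>m\<close>. It
      does not depend on \<open>n\<close>, so \<open>C / real n\<close> falls below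
      \<open>e / 2\<close> by the choice of \<open>N\<close>.\<close>
    define C where "C = (\<Sum>r<m. a r)"
    have C: "a r \<le> C" if "r < m" for r
      unfolding C_def by (rule member_le_sum) (use that nn in auto)
    obtain N where N: "C / (e / 2) < real N" using reals_Archimedean2 by blast
    show "\<exists>N. \<forall>n\<ge>N. norm (1 / real n * a n - L) < e"
    \<comment> \<open>Starting at \<open>Suc N\<close> also excludes \<open>n = 0\<close>.\<close>
    proof (intro exI[of _ "Suc N"] allI impI)
      fix n assume n: "n \<ge> Suc N"
      then have n0: "real n > 0" by simp
      have "a n \<le> real (n div m) * a m + a (n mod m)" using mult[of "n div m" m "n mod m"] by simp
      also have "\<dots> \<le> real (n div m) * a m + C" using C[of "n mod m"] m(1) by simp
      finally have "a n / real n \<le> (real (n div m) * a m + C) / real n"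
        using n0 by (simp add: divide_right_mono)
      also have "\<dots> = real (n div m) * real m / real n * (a m / real m) + C / real n"
        using m(1) by (simp add: add_divide_distrib)
      also have "real (n div m) * real m / real n * (a m / real m) \<le> 1 * (a m / real m)"
      proof (rule mult_right_mono)
        have "real (n div m) * real m \<le> real n"
          by (metis of_nat_mult of_nat_le_iff div_times_less_eq_dividend)
        then show "real (n div m) * real m / real n \<le> 1" using n0 by simp
      qed (simp add: nn)
      also have "C / real n < e / 2"
      proof -
        have "C / (e / 2) < real n" using N n by linarith
        then show ?thesis using e n0 by (simp add: field_simps)
      qed
      finally have "a n / real n < L + e" using m(2) by simp
      moreover have "L \<le> a n / real n" using low n by simp
      ultimately show "norm (1 / real n * a n - L) < e" by simp
    qed
  qed
  then show ?thesis by (rule convergentI)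
qed

text \<open>Suprema over two independent index sets are pulled out one at a time; nonnegativity
  rules out \<open>-\<infinity>\<close>, where addition in \<open>ereal\<close> does not commute
  with suprema.\<close>

lemma SUP_add_le:
  fixes f :: "'a \<Rightarrow> ereal" and g :: "'b \<Rightarrow> ereal"
  assumes "A \<noteq> {}" "B \<noteq> {}" "\<And>x. x \<in> A \<Longrightarrow> 0 \<le> f x" "\<And>y. y \<in> B \<Longrightarrow> 0 \<le> g y"
    and le: "\<And>x y. x \<in> A \<Longrightarrow> y \<in> B \<Longrightarrow> f x + g y \<le> c"
  shows "(SUP x\<in>A. f x) + (SUP y\<in>B. g y) \<le> c"
proof -
  have "0 \<le> (SUP y\<in>B. g y)" using assms(2,4) by (auto intro: SUP_upper2)
  then have "(SUP y\<in>B. g y) \<noteq> -\<infinity>" by auto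
  then have "(SUP x\<in>A. f x) + (SUP y\<in>B. g y) = (SUP x\<in>A. f x + (SUP y\<in>B. g y))"
    by (rule SUP_ereal_add_left[OF assms(1), symmetric])
  also have "\<dots> \<le> c"
  proof (rule SUP_least)
    fix x assume x: "x \<in> A"
    then have "f x \<noteq> -\<infinity>" using assms(3)[OF x] by auto
    then have "f x + (SUP y\<in>B. g y) = (SUP y\<in>B. f x + g y)"
      by (rule SUP_ereal_add_right[OF assms(2), symmetric])
    also have "\<dots> \<le> c" by (rule SUP_least) (rule le[OF x])
    finally show "f x + (SUP y\<in>B. g y) \<le> c" .
  qed
  finally show ?thesis .
qed

locale autonomous_ims = nds_ims X f \<mu> for X :: "nat \<Rightarrow> 'a metric" and f \<mu> +
  fixes m :: "'a metric" and T :: "'a \<Rightarrow> 'a" and M :: "'a measure"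
  assumes auto: "autonomous X f \<mu> m T M" and fine: "fine_scale_ims X f \<mu>"
begin

lemma X_eq: "X n = m" and f_eq: "x \<in> mspace m \<Longrightarrow> f n x = T x" and \<mu>_eq: "\<mu> n = M"
  using auto by (simp_all add: autonomous_def)

lemma iter_in_space: "x \<in> mspace m \<Longrightarrow> nds_iter f 0 n x \<in> mspace m"
  using measurable_space[OF measurable_nds_iter, of x n] by (simp add: space_ims X_eq)

lemma iter_eq: "x \<in> mspace m \<Longrightarrow> nds_iter f 0 n x = (T ^^ n) x"
proof (induction n)
  case (Suc n)
  then show ?case using iter_in_space[of x n] by (simp add: f_eq)
qed simp

text \<open>An itinerary of length \<open>n + k\<close> is one of length \<open>n\<close> followed
  by the itinerary of length \<open>k\<close> of the point reached at time \<open>n\<close>.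
  Invariance gives the latter the entropy it has at time 0.\<close>

lemma block_entropy_const_add_le:
  assumes Q: "borel_partition m Q"
  shows "block_entropy f \<mu> (\<lambda>_. Q) (n + k) \<le> block_entropy f \<mu> (\<lambda>_. Q) n + block_entropy f \<mu> (\<lambda>_. Q) k"
proof -
  interpret M: prob_space M using prob_space_ims[of 0] by (simp add: \<mu>_eq)
  let ?h = "itinerary (nds_iter f 0) (\<lambda>_. cells Q)"
  have s: "simple_function M (?h n)" for n
    using simple_function_itinerary_cells[of "\<lambda>_. Q" n] Q by (simp add: X_eq \<mu>_eq)
  have T: "nds_iter f 0 n \<in> measurable M M" "distr M M (nds_iter f 0 n) = M" for n
    using measurable_nds_iter[of n] distr_nds_iter[of n] by (simp_all add: \<mu>_eq)
  have sp: "space M = mspace m" using space_ims[of 0] by (simp add: \<mu>_eq X_eq)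
  have s2: "simple_function M (?h k \<circ> nds_iter f 0 n)"
    using simple_function_comp[OF T(1) s] by (simp add: comp_def)
  have "fun_entropy M (?h (n + k)) \<le> fun_entropy M (\<lambda>x. (?h n x, (?h k \<circ> nds_iter f 0 n) x))"
  proof (rule M.fun_entropy_mono[OF simple_function_Pair[OF s s2]])
    fix x y assume x: "x \<in> space M" and y: "y \<in> space M"
      and e: "(?h n x, (?h k \<circ> nds_iter f 0 n) x) = (?h n y, (?h k \<circ> nds_iter f 0 n) y)"
    \<comment> \<open>Autonomy enters here: restarting at time 0 from the point reached at time
      \<open>n\<close> continues the same orbit.\<close>
    have shift: "nds_iter f 0 j (nds_iter f 0 n z) = nds_iter f 0 (n + j) z" if z: "z \<in> space M" for j z
    proof -
      have z: "z \<in> mspace m" using z sp by simp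
      have "nds_iter f 0 j (nds_iter f 0 n z) = (T ^^ j) ((T ^^ n) z)"
        using iter_eq[OF iter_in_space[OF z], of j n] by (simp only: iter_eq[OF z])
      also have "\<dots> = (T ^^ (n + j)) z" by (simp only: add.commute[of n] funpow_add comp_apply)
      finally show ?thesis by (simp only: iter_eq[OF z])
    qed
    have "cells Q (nds_iter f 0 i x) = cells Q (nds_iter f 0 i y)" if i: "i < n + k" for i
    proof (cases "i < n")
      case True
      then show ?thesis using e by (simp add: itinerary_eq_iff)
    next
      case False
      then have "i - n < k" using i by simp
      then have "cells Q (nds_iter f 0 (i - n) (nds_iter f 0 n x)) = cells Q (nds_iter f 0 (i - n) (nds_iter f 0 n y))"
        using e unfolding prod.inject comp_apply itinerary_eq_iff by blast
      then show ?thesis using False by (simp add: shift x y)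
    qed
    then show "?h (n + k) x = ?h (n + k) y" unfolding itinerary_eq_iff by blast
  qed
  also have "\<dots> \<le> fun_entropy M (?h n) + fun_entropy M (?h k \<circ> nds_iter f 0 n)"
    by (rule M.fun_entropy_Pair_le[OF s s2])
  also have "fun_entropy M (?h k \<circ> nds_iter f 0 n) = fun_entropy M (?h k)"
    by (rule fun_entropy_distr[OF T s])
  finally show ?thesis by (simp add: block_entropy_def \<mu>_eq)
qed

lemma block_entropy_const_convergent:
  assumes "borel_partition m Q"
  shows "convergent (\<lambda>n. 1 / real n * block_entropy f \<mu> (\<lambda>_. Q) n)"
  by (rule subadditive_convergent) (rule block_entropy_nonneg, rule block_entropy_const_add_le[OF assms])

text \<open>Inner regularity supplies a compact core in each cell; disjoint compact sets have
  positive distance, and there are finitely many pairs. Cores and separation serve for all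
  times.\<close>

lemma admissible_const:
  assumes Q: "borel_partition m Q"
  shows "(\<lambda>_. Q) \<in> admissible X \<mu>"
  unfolding admissible_def mem_Collect_eq X_eq \<mu>_eq
proof (intro conjI allI impI)
  fix e :: real assume e: "e > 0"
  interpret M: prob_space M using prob_space_ims[of 0] by (simp add: \<mu>_eq)
  have sp: "space M = mspace m" and st: "sets M = sets (mborel m)"
    and c: "compact_space (mtopology_of m)"
    using space_ims[of 0] sets_ims[of 0] compact_nds[of 0] by (simp_all add: \<mu>_eq X_eq)
  have "\<forall>A\<in>Q. \<exists>K. compactin (mtopology_of m) K \<and> K \<subseteq> A \<and> measure M (A - K) \<le> e"
  proof
    fix A assume "A \<in> Q"
    then have "A \<in> sets M" using Q st by (auto simp: borel_partition_def)
    from compactin_inner_approx[OF M.finite_measure_axioms sp st c this e]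
    show "\<exists>K. compactin (mtopology_of m) K \<and> K \<subseteq> A \<and> measure M (A - K) \<le> e" by metis
  qed
  then obtain K where K: "\<And>A. A \<in> Q \<Longrightarrow> compactin (mtopology_of m) (K A)"
    "\<And>A. A \<in> Q \<Longrightarrow> K A \<subseteq> A" "\<And>A. A \<in> Q \<Longrightarrow> measure M (A - K A) \<le> e" by metis
  have pair: "\<exists>d>0. \<forall>x\<in>K A. \<forall>y\<in>K B. mdist m x y \<ge> d" if AB: "A \<in> Q" "B \<in> Q" "A \<noteq> B" for A B
  proof -
    have "A \<inter> B = {}" using disjointD[of Q A B] Q AB by (simp add: borel_partition_def partition_on_def)
    then have "K A \<inter> K B = {}" using K(2)[OF AB(1)] K(2)[OF AB(2)] by blast
    then show ?thesis using compactin_separated[OF K(1)[OF AB(1)] K(1)[OF AB(2)]] by blast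
  qed
  \<comment> \<open>Stated for all \<open>p\<close>, so that \<open>d\<close> is positive
    everywhere, also on the pairs with equal components that enter the minimum.\<close>
  have "\<forall>p. \<exists>d>0. p \<in> Q \<times> Q \<longrightarrow> fst p \<noteq> snd p \<longrightarrow> (\<forall>x\<in>K (fst p). \<forall>y\<in>K (snd p). mdist m x y \<ge> d)"
    using pair by (metis mem_Times_iff zero_less_one)
  then obtain d where d: "\<And>p. d p > 0"
    "\<And>p x y. \<lbrakk>p \<in> Q \<times> Q; fst p \<noteq> snd p; x \<in> K (fst p); y \<in> K (snd p)\<rbrakk> \<Longrightarrow> mdist m x y \<ge> d p"
    by metis
  define D where "D = Min (insert 1 (d ` (Q \<times> Q)))"
  have fin: "finite (insert 1 (d ` (Q \<times> Q)))" using Q by (simp add: borel_partition_def)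
  have "D > 0" unfolding D_def using fin d(1) by (subst Min_gr_iff) auto
  moreover have "mdist m x y \<ge> D" if "A \<in> Q" "B \<in> Q" "A \<noteq> B" "x \<in> K A" "y \<in> K B" for A B x y
  proof -
    have "D \<le> d (A, B)" unfolding D_def by (rule Min_le[OF fin]) (use that in auto)
    also have "\<dots> \<le> mdist m x y" by (rule d(2)) (use that in auto)
    finally show ?thesis .
  qed
  ultimately show "\<exists>\<delta>>0. \<exists>K. (\<forall>n::nat. \<forall>A\<in>Q. compactin (mtopology_of m) (K n A) \<and> K n A \<subseteq> A \<and> measure M (A - K n A) \<le> e) \<and>
      (\<forall>n::nat. \<forall>A\<in>Q. \<forall>B\<in>Q. A \<noteq> B \<longrightarrow> (\<forall>x\<in>K n A. \<forall>y\<in>K n B. \<delta> \<le> mdist m x y))"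
    using K by (intro exI[of _ D] conjI exI[of _ "\<lambda>_. K"]) auto
qed (use Q in auto)

text \<open>Subadditivity makes the averages converge, so the \<open>lim\<close> of the one
  definition is the \<open>limsup\<close> of the other. The powers of \<open>T\<close> and the
  iterates of \<open>f\<close> need agree on the space only, since pullbacks are intersected with
  it.\<close>

lemma ks_entropy_eq_SUP_const:
  "ks_entropy M T = (SUP Q\<in>Collect (borel_partition m). nds_entropy_partition X f \<mu> (\<lambda>_. Q))"
proof -
  have sp: "space M = mspace m" and st: "sets M = sets (mborel m)"
    using space_ims[of 0] sets_ims[of 0] by (simp_all add: \<mu>_eq X_eq)
  have I: "{Q. finite Q \<and> partition_on (space M) Q \<and> Q \<subseteq> sets M} = Collect (borel_partition m)"
    by (auto simp: borel_partition_def sp st)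
  have "lim (\<lambda>n. ereal (1 / real n * partition_entropy M
       (common_refinement ((\<lambda>i. pullback_partition (space M) (T ^^ i) Q) ` {..<n}))))
     = nds_entropy_partition X f \<mu> (\<lambda>_. Q)" if Q: "borel_partition m Q" for Q
  proof -
    have pb: "pullback_partition (space M) (T ^^ i) Q = pullback_partition (mspace (X 0)) (nds_iter f 0 i) Q" for i
    proof -
      have "(T ^^ i) -` A \<inter> mspace m = nds_iter f 0 i -` A \<inter> mspace m" for A
        by (auto simp: iter_eq)
      then show ?thesis by (simp add: pullback_partition_def sp X_eq)
    qed
    have Qb: "borel_partition (X n) Q" for n using Q by (simp add: X_eq)
    let ?s = "\<lambda>n. 1 / real n * block_entropy f \<mu> (\<lambda>_. Q) n"
    have "ereal (1 / real n * partition_entropy M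
       (common_refinement ((\<lambda>i. pullback_partition (space M) (T ^^ i) Q) ` {..<n}))) = ereal (?s n)" for n
      using partition_entropy_eq_block_entropy[of "\<lambda>_. Q" n, OF Qb] unfolding pb
      by (cases "n = 0") (simp_all add: \<mu>_eq)
    then have e: "(\<lambda>n. ereal (1 / real n * partition_entropy M
       (common_refinement ((\<lambda>i. pullback_partition (space M) (T ^^ i) Q) ` {..<n})))) = (\<lambda>n. ereal (?s n))"
      by (rule ext)
    obtain L where "?s \<longlonglongrightarrow> L" using block_entropy_const_convergent[OF Q] by (auto simp: convergent_def)
    then have "(\<lambda>n. ereal (?s n)) \<longlonglongrightarrow> ereal L" by simp
    then have "lim (\<lambda>n. ereal (?s n)) = ereal L" "limsup (\<lambda>n. ereal (?s n)) = ereal L"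
      by (rule limI, intro lim_imp_Limsup) simp_all
    then show ?thesis unfolding e nds_entropy_partition_eq[of "\<lambda>_. Q", OF Qb] by simp
  qed
  then show ?thesis unfolding ks_entropy_def I by (intro SUP_cong) auto
qed

text \<open>Given an admissible \<open>Q\<close>, the partition \<open>P 0\<close> of a fine
  sequence, repeated at all times, is finer than the separation of the cores of \<open>Q\<close>,
  because all times carry the same metric.\<close>

lemma nds_entropy_eq_SUP_const:
  "nds_entropy X f \<mu> = (SUP Q\<in>Collect (borel_partition m). nds_entropy_partition X f \<mu> (\<lambda>_. Q))"
proof (rule antisym)
  show "(SUP Q\<in>Collect (borel_partition m). nds_entropy_partition X f \<mu> (\<lambda>_. Q)) \<le> nds_entropy X f \<mu>"
    unfolding nds_entropy_def by (rule SUP_least, rule SUP_upper) (simp add: admissible_const)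
  show "nds_entropy X f \<mu> \<le> (SUP Q\<in>Collect (borel_partition m). nds_entropy_partition X f \<mu> (\<lambda>_. Q))"
    unfolding nds_entropy_def
  proof (rule SUP_least)
    fix Q assume Q: "Q \<in> admissible X \<mu>"
    show "nds_entropy_partition X f \<mu> Q \<le> (SUP Q\<in>Collect (borel_partition m). nds_entropy_partition X f \<mu> (\<lambda>_. Q))"
    proof (rule ereal_le_epsilon2)
      fix e :: real assume e: "e > 0"
      show "nds_entropy_partition X f \<mu> Q \<le> (SUP Q\<in>Collect (borel_partition m). nds_entropy_partition X f \<mu> (\<lambda>_. Q)) + ereal e"
      proof (rule nds_entropy_partition_le_fine[OF Q e])
        fix d :: real assume d: "d > 0"
          and le: "\<And>P. \<lbrakk>\<And>n. borel_partition (X n) (P n);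
              \<And>n A x y. \<lbrakk>A \<in> P n; x \<in> A; y \<in> A\<rbrakk> \<Longrightarrow> mdist (X n) x y < d\<rbrakk>
            \<Longrightarrow> nds_entropy_partition X f \<mu> Q \<le> nds_entropy_partition X f \<mu> P + ereal e"
        obtain P where P: "P \<in> admissible X \<mu>" "\<And>n A x y. \<lbrakk>A \<in> P n; x \<in> A; y \<in> A\<rbrakk> \<Longrightarrow> mdist (X n) x y < d"
          by (rule fine_scale_ims_obtain[OF fine d], rule that)
        have b: "borel_partition m (P 0)" using admissible_borel_partition[OF P(1), of 0] by (simp add: X_eq)
        have "nds_entropy_partition X f \<mu> Q \<le> nds_entropy_partition X f \<mu> (\<lambda>_. P 0) + ereal e"
          by (rule le) (use b P(2)[where n = 0] in \<open>simp_all add: X_eq\<close>)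
        also have "nds_entropy_partition X f \<mu> (\<lambda>_. P 0)
            \<le> (SUP Q\<in>Collect (borel_partition m). nds_entropy_partition X f \<mu> (\<lambda>_. Q))"
          using b by (intro SUP_upper) simp
        finally show ?thesis by (simp add: add_right_mono)
      qed
    qed
  qed
qed

lemma ks_entropy_eq: "ks_entropy M T = nds_entropy X f \<mu>"
  by (simp add: ks_entropy_eq_SUP_const nds_entropy_eq_SUP_const)

text \<open>Constant sequences have an entropy limit, so the limsup of the sum splits.\<close>
lemma nds_entropy_add_le:
  assumes P: "\<And>P. P \<in> S \<Longrightarrow> 0 \<le> limsup (\<lambda>n. ereal (u P n))"
    and S: "S \<noteq> {}"
    and le: "\<And>P R. P \<in> S \<Longrightarrow> R \<in> admissible X \<mu> \<Longrightarrow>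
      limsup (\<lambda>n. ereal (1 / real n * block_entropy f \<mu> R n) + ereal (u P n)) \<le> c"
  shows "nds_entropy X f \<mu> + (SUP P\<in>S. limsup (\<lambda>n. ereal (u P n))) \<le> c"
  unfolding nds_entropy_eq_SUP_const
proof (rule SUP_add_le)
  obtain P where "P \<in> admissible X \<mu>"
    using fine by (auto simp: fine_scale_ims_def)
  then have "borel_partition m (P 0)" using admissible_borel_partition[of P X \<mu> 0] by (simp add: X_eq)
  then show "Collect (borel_partition m) \<noteq> {}" by auto
  fix Q assume "Q \<in> Collect (borel_partition m)"
  then have Q: "borel_partition m Q" by simp
  then have Qb: "borel_partition (X n) Q" for n by (simp add: X_eq)
  show "0 \<le> nds_entropy_partition X f \<mu> (\<lambda>_. Q)" by (rule nds_entropy_partition_nonneg[OF Qb])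
  fix P assume P': "P \<in> S"
  let ?s = "\<lambda>n. 1 / real n * block_entropy f \<mu> (\<lambda>_. Q) n"
  obtain L where L: "?s \<longlonglongrightarrow> L" using block_entropy_const_convergent[OF Q] by (auto simp: convergent_def)
  then have L': "(\<lambda>n. ereal (?s n)) \<longlonglongrightarrow> ereal L" by simp
  have "nds_entropy_partition X f \<mu> (\<lambda>_. Q) = ereal L"
    unfolding nds_entropy_partition_eq[of "\<lambda>_. Q", OF Qb] using L' by (rule lim_imp_Limsup[rotated]) simp
  then have "nds_entropy_partition X f \<mu> (\<lambda>_. Q) + limsup (\<lambda>n. ereal (u P n))
      = limsup (\<lambda>n. ereal (?s n) + ereal (u P n))"
    using ereal_limsup_lim_add[OF L', of "\<lambda>n. ereal (u P n)"] by (simp del: plus_ereal.simps)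
  also have "\<dots> \<le> c" by (rule le[OF P' admissible_const[OF Q]])
  finally show "nds_entropy_partition X f \<mu> (\<lambda>_. Q) + limsup (\<lambda>n. ereal (u P n)) \<le> c" .
qed (use S P in auto)

end

section \<open>Lower bounds and the three cases\<close>

lemma (in nds_ims) nds_entropy_eq_SUP_limsup:
  "nds_entropy X f \<mu> = (SUP P\<in>admissible X \<mu>. limsup (\<lambda>n. ereal (1 / real n * block_entropy f \<mu> P n)))"
  unfolding nds_entropy_def
  by (rule SUP_cong[OF refl], rule nds_entropy_partition_eq, rule admissible_borel_partition)

text \<open>Block entropies of \<open>R\<close> are nonnegative, so adding them cannot lower the
  limsup. When the second entropy is 0, this meets the upper bound.\<close>

lemma nds_entropy_le_prod:
  assumes X: "nds_ims X f \<mu>" and Y: "nds_ims Y g \<nu>" and R: "R \<in> admissible Y \<nu>"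
  shows "nds_entropy X f \<mu> \<le> nds_entropy (prod_spaces X Y) (prod_maps f g) (prod_measures \<mu> \<nu>)"
  unfolding nds_ims.nds_entropy_eq_SUP_limsup[OF X]
proof (rule SUP_least)
  fix P assume P: "P \<in> admissible X \<mu>"
  have "limsup (\<lambda>n. ereal (1 / real n * block_entropy f \<mu> P n))
      \<le> limsup (\<lambda>n. ereal (1 / real n * block_entropy f \<mu> P n) + ereal (1 / real n * block_entropy g \<nu> R n))"
    by (intro Limsup_mono always_eventually allI) (simp add: nds_ims.block_entropy_nonneg[OF Y])
  also have "\<dots> \<le> nds_entropy (prod_spaces X Y) (prod_maps f g) (prod_measures \<mu> \<nu>)"
    by (rule nds_entropy_prod_ge[OF X Y P R])
  finally show "limsup (\<lambda>n. ereal (1 / real n * block_entropy f \<mu> P n))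
      \<le> nds_entropy (prod_spaces X Y) (prod_maps f g) (prod_measures \<mu> \<nu>)" .
qed

text \<open>The same sequence \<open>P\<close> in both factors doubles each block entropy, and the
  limsup doubles with it. For different \<open>P\<close> and \<open>R\<close>, the sum is at most
  twice the larger term.\<close>

lemma nds_entropy_prod_self:
  assumes X: "nds_ims X f \<mu>" and fine: "fine_scale_ims X f \<mu>"
  shows "nds_entropy (prod_spaces X X) (prod_maps f f) (prod_measures \<mu> \<mu>) = nds_entropy X f \<mu> + nds_entropy X f \<mu>"
    (is "?h = _")
proof (rule antisym)
  show "?h \<le> nds_entropy X f \<mu> + nds_entropy X f \<mu>"
    by (rule nds_entropy_prod_le[OF X X fine fine])
  interpret nds_ims X f \<mu> by (rule X)
  let ?u = "\<lambda>P. limsup (\<lambda>n. ereal (1 / real n * block_entropy f \<mu> P n))"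
  have double: "?u P + ?u P \<le> ?h" if P: "P \<in> admissible X \<mu>" for P
  proof -
    \<comment> \<open>Multiplication by a positive finite constant passes through the limsup,
      whereas a sum in general does not.\<close>
    have "?u P + ?u P = ereal 2 * ?u P" by (simp add: mult_2_ereal)
    also have "\<dots> = limsup (\<lambda>n. ereal 2 * ereal (1 / real n * block_entropy f \<mu> P n))"
      by (rule ereal_limsup_lim_mult[symmetric]) auto
    also have "\<dots> = limsup (\<lambda>n. ereal (1 / real n * block_entropy f \<mu> P n) + ereal (1 / real n * block_entropy f \<mu> P n))"
      by (simp only: mult_2_ereal)
    also have "\<dots> \<le> ?h" by (rule nds_entropy_prod_ge[OF X X P P])
    finally show ?thesis .
  qed
  show "nds_entropy X f \<mu> + nds_entropy X f \<mu> \<le> ?h"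
    unfolding nds_entropy_eq_SUP_limsup
  proof (rule SUP_add_le)
    show "admissible X \<mu> \<noteq> {}" "admissible X \<mu> \<noteq> {}" using fine by (auto simp: fine_scale_ims_def)
    fix P assume P: "P \<in> admissible X \<mu>"
    show pos: "0 \<le> ?u P" "0 \<le> ?u P"
      using nds_entropy_partition_nonneg[OF admissible_borel_partition[OF P]]
      by (simp_all add: nds_entropy_partition_eq[OF admissible_borel_partition[OF P]])
    fix R assume R: "R \<in> admissible X \<mu>"
    show "?u P + ?u R \<le> ?h"
    proof (cases "?u P \<le> ?u R")
      case True
      then have "?u P + ?u R \<le> ?u R + ?u R" by (rule add_right_mono)
      also have "\<dots> \<le> ?h" by (rule double[OF R])
      finally show ?thesis .
    next
      case False
      then have "?u P + ?u R \<le> ?u P + ?u P" by (intro add_left_mono) simp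
      also have "\<dots> \<le> ?h" by (rule double[OF P])
      finally show ?thesis .
    qed
  qed
qed

theorem proposition3p17:
  fixes X :: "nat \<Rightarrow> 'a metric" and f :: "nat \<Rightarrow> 'a \<Rightarrow> 'a" and \<mu> :: "nat \<Rightarrow> 'a measure"
    and Y :: "nat \<Rightarrow> 'b metric" and g :: "nat \<Rightarrow> 'b \<Rightarrow> 'b" and \<nu> :: "nat \<Rightarrow> 'b measure"
  assumes "topological_nds X f" and "fine_scale_ims X f \<mu>"
    and "topological_nds Y g" and "fine_scale_ims Y g \<nu>"
  shows
    "(nds_entropy Y g \<nu> = 0 \<longrightarrow>
        nds_entropy (prod_spaces X Y) (prod_maps f g) (prod_measures \<mu> \<nu>)
          = nds_entropy X f \<mu> + nds_entropy Y g \<nu> \<and>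
        nds_entropy (prod_spaces X Y) (prod_maps f g) (prod_measures \<mu> \<nu>) = nds_entropy X f \<mu>) \<and>
     (\<forall>m T M. autonomous Y g \<nu> m T M \<longrightarrow>
        nds_entropy (prod_spaces X Y) (prod_maps f g) (prod_measures \<mu> \<nu>)
          = nds_entropy X f \<mu> + nds_entropy Y g \<nu> \<and>
        nds_entropy (prod_spaces X Y) (prod_maps f g) (prod_measures \<mu> \<nu>)
          = nds_entropy X f \<mu> + ks_entropy M T) \<and>
     (\<forall>m T M. autonomous X f \<mu> m T M \<longrightarrow>
        nds_entropy (prod_spaces X Y) (prod_maps f g) (prod_measures \<mu> \<nu>)
          = nds_entropy X f \<mu> + nds_entropy Y g \<nu> \<and>
        nds_entropy (prod_spaces X Y) (prod_maps f g) (prod_measures \<mu> \<nu>)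
          = ks_entropy M T + nds_entropy Y g \<nu>) \<and>
     (nds_entropy (prod_spaces X X) (prod_maps f f) (prod_measures \<mu> \<mu>)
          = nds_entropy X f \<mu> + nds_entropy X f \<mu> \<and>
      nds_entropy (prod_spaces X X) (prod_maps f f) (prod_measures \<mu> \<mu>)
          = 2 * nds_entropy X f \<mu>)"
proof -
  let ?h = "nds_entropy (prod_spaces X Y) (prod_maps f g) (prod_measures \<mu> \<nu>)"
  have X: "nds_ims X f \<mu>" and Y: "nds_ims Y g \<nu>"
    using assms by (simp_all add: nds_ims_def fine_scale_ims_def)
  have le: "?h \<le> nds_entropy X f \<mu> + nds_entropy Y g \<nu>"
    by (rule nds_entropy_prod_le[OF X Y assms(2,4)])
  have nonempty: "admissible X \<mu> \<noteq> {}" "admissible Y \<nu> \<noteq> {}"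
    using assms(2,4) by (auto simp: fine_scale_ims_def)
  have pos: "0 \<le> limsup (\<lambda>n. ereal (1 / real n * block_entropy f \<mu> P n))" if "P \<in> admissible X \<mu>" for P
    using nds_ims.nds_entropy_partition_nonneg[OF X admissible_borel_partition[OF that]]
    by (simp add: nds_ims.nds_entropy_partition_eq[OF X admissible_borel_partition[OF that]])
  have pos': "0 \<le> limsup (\<lambda>n. ereal (1 / real n * block_entropy g \<nu> R n))" if "R \<in> admissible Y \<nu>" for R
    using nds_ims.nds_entropy_partition_nonneg[OF Y admissible_borel_partition[OF that]]
    by (simp add: nds_ims.nds_entropy_partition_eq[OF Y admissible_borel_partition[OF that]])
  have a: "?h = nds_entropy X f \<mu>" if zero: "nds_entropy Y g \<nu> = 0"
  proof (rule antisym)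
    show "?h \<le> nds_entropy X f \<mu>" using le zero by simp
    obtain R where "R \<in> admissible Y \<nu>" using nonempty(2) by blast
    then show "nds_entropy X f \<mu> \<le> ?h" by (rule nds_entropy_le_prod[OF X Y])
  qed
  have b: "?h = nds_entropy X f \<mu> + nds_entropy Y g \<nu> \<and> ks_entropy M T = nds_entropy Y g \<nu>"
    if aut: "autonomous Y g \<nu> m T M" for m T M
  proof -
    interpret Y: autonomous_ims Y g \<nu> m T M
      using Y aut assms(4) by (simp add: autonomous_ims_def autonomous_ims_axioms_def)
    \<comment> \<open>The autonomous system is the first summand in the additivity result, hence the
      exchanged order here and the commutation below.\<close>
    have "nds_entropy Y g \<nu> + nds_entropy X f \<mu> \<le> ?h"
      unfolding nds_ims.nds_entropy_eq_SUP_limsup[OF X]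
    proof (rule Y.nds_entropy_add_le[OF pos nonempty(1)])
      fix P R assume "P \<in> admissible X \<mu>" "R \<in> admissible Y \<nu>"
      from nds_entropy_prod_ge[OF X Y this]
      show "limsup (\<lambda>n. ereal (1 / real n * block_entropy g \<nu> R n) + ereal (1 / real n * block_entropy f \<mu> P n)) \<le> ?h"
        by (subst add.commute)
    qed
    then have "?h = nds_entropy X f \<mu> + nds_entropy Y g \<nu>"
      using le by (intro antisym) (simp_all only: add.commute)
    then show ?thesis using Y.ks_entropy_eq by blast
  qed
  have b': "?h = nds_entropy X f \<mu> + nds_entropy Y g \<nu> \<and> ks_entropy M T = nds_entropy X f \<mu>"
    if aut: "autonomous X f \<mu> m T M" for m T M
  proof -
    interpret X: autonomous_ims X f \<mu> m T M
      using X aut assms(2) by (simp add: autonomous_ims_def autonomous_ims_axioms_def)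
    have "nds_entropy X f \<mu> + nds_entropy Y g \<nu> \<le> ?h"
      unfolding nds_ims.nds_entropy_eq_SUP_limsup[OF Y]
      by (rule X.nds_entropy_add_le[OF pos' nonempty(2)], assumption, rule nds_entropy_prod_ge[OF X Y])
    then have "?h = nds_entropy X f \<mu> + nds_entropy Y g \<nu>" using le by (rule antisym[rotated])
    then show ?thesis using X.ks_entropy_eq by blast
  qed
  have c: "nds_entropy (prod_spaces X X) (prod_maps f f) (prod_measures \<mu> \<mu>)
      = nds_entropy X f \<mu> + nds_entropy X f \<mu>"
    by (rule nds_entropy_prod_self[OF X assms(2)])
  have two: "nds_entropy X f \<mu> + nds_entropy X f \<mu> = 2 * nds_entropy X f \<mu>"
    using mult_2_ereal[of "nds_entropy X f \<mu>"] by simp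
  show ?thesis
  proof (intro conjI impI allI)
    assume "nds_entropy Y g \<nu> = 0"
    with a show "?h = nds_entropy X f \<mu> + nds_entropy Y g \<nu>" "?h = nds_entropy X f \<mu>" by simp_all
  next
    fix m T M assume "autonomous Y g \<nu> m T M"
    from b[OF this] show "?h = nds_entropy X f \<mu> + nds_entropy Y g \<nu>" "?h = nds_entropy X f \<mu> + ks_entropy M T"
      by simp_all
  next
    fix m T M assume "autonomous X f \<mu> m T M"
    from b'[OF this] show "?h = nds_entropy X f \<mu> + nds_entropy Y g \<nu>" "?h = ks_entropy M T + nds_entropy Y g \<nu>"
      by simp_all
  next
    show "nds_entropy (prod_spaces X X) (prod_maps f f) (prod_measures \<mu> \<mu>)
        = nds_entropy X f \<mu> + nds_entropy X f \<mu>" by (rule c)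
    show "nds_entropy (prod_spaces X X) (prod_maps f f) (prod_measures \<mu> \<mu>) = 2 * nds_entropy X f \<mu>"
      unfolding c by (rule two)
  qed
qed

end
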